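(* Let $\kappa$ be a cardinal, let $\{L_\alpha : \alpha<\kappa\}$ be a collection of compact linearly ordered spaces, and for each $\alpha<\kappa$ let $D_\alpha$ be a dense subset of $L_\alpha$ which contains all pairs of adjacent points of $L_\alpha$. Then the Banach space $C(\prod_{\alpha<\kappa}L_\alpha)$ has a norm which is equivalent to the supremum norm and is $\tau_p(\prod_{\alpha<\kappa}D_\alpha)$-Kadec.
   Context: A linearly ordered space is a linearly ordered set with its order topology; compact spaces are Hausdorff. Points $x,y$ of a linearly ordered space are adjacent if $x\neq y$ and no point lies strictly between them; a set contains all pairs of adjacent points if $x,y$ belong to it whenever $x,y$ are adjacent. For compact $K$, $C(K)$ is the Banach space of real-valued continuous functions on $K$ with the supremum norm. For $D\subseteq K$, $\tau_p(D)$ is the topology on $C(K)$ of pointwise convergence on $D$. A norm on a vector space $X$ is $\tau$-Kadec, for a vector space topology $\tau$ on $X$ weaker than the norm topology, if the norm topology and $\tau$ coincide on the unit sphere of that norm. *)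

theory Defs
  imports "HOL-Analysis.Analysis"
begin

section \<open>Linearly ordered spaces\<close>

text \<open>
  A linearly ordered set is a carrier \<open>A\<close> with a reflexive relation \<open>r\<close> such that
  \<open>linear_order_on A r\<close>. The carrier itself is put into the subbasis so that it is the
  whole space also when it has a single point (and hence no nonempty open ray).
\<close>

definition order_top_of :: "'a set \<Rightarrow> ('a \<times> 'a) set \<Rightarrow> 'a topology" where
  "order_top_of A r = topology_generated_by
     ({A} \<union> {{x \<in> A. (x, a) \<in> r \<and> x \<noteq> a} | a. a \<in> A}
          \<union> {{x \<in> A. (a, x) \<in> r \<and> x \<noteq> a} | a. a \<in> A})"

definition strictly_between :: "('a \<times> 'a) set \<Rightarrow> 'a \<Rightarrow> 'a \<Rightarrow> 'a \<Rightarrow> bool" where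
  "strictly_between r x z y \<longleftrightarrow>
     z \<noteq> x \<and> z \<noteq> y \<and> ((x, z) \<in> r \<and> (z, y) \<in> r \<or> (y, z) \<in> r \<and> (z, x) \<in> r)"

definition adjacent_in :: "'a set \<Rightarrow> ('a \<times> 'a) set \<Rightarrow> 'a \<Rightarrow> 'a \<Rightarrow> bool" where
  "adjacent_in A r x y \<longleftrightarrow>
     x \<in> A \<and> y \<in> A \<and> x \<noteq> y \<and> \<not> (\<exists>z\<in>A. strictly_between r x z y)"

definition contains_adjacent_pairs :: "'a set \<Rightarrow> ('a \<times> 'a) set \<Rightarrow> 'a set \<Rightarrow> bool" where
  "contains_adjacent_pairs A r D \<longleftrightarrow> (\<forall>x y. adjacent_in A r x y \<longrightarrow> x \<in> D \<and> y \<in> D)"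

definition dense_subset_of :: "'a topology \<Rightarrow> 'a set \<Rightarrow> bool" where
  "dense_subset_of X D \<longleftrightarrow> D \<subseteq> topspace X \<and> X closure_of D = topspace X"


section \<open>Spaces of continuous functions\<close>

text \<open>
  The space \<open>C(K)\<close>. HOL functions are total, so a function on \<open>K\<close> is represented by its
  extension by \<open>0\<close>; the representatives then form a linear space under the pointwise
  operations. (The usual extension by \<open>undefined\<close> is not preserved by these.)
\<close>

definition cont_functions :: "'x topology \<Rightarrow> ('x \<Rightarrow> real) set" where
  "cont_functions K =
     {f. continuous_map K euclideanreal f \<and> (\<forall>x. x \<notin> topspace K \<longrightarrow> f x = 0)}"

text \<open>Inserting \<open>0\<close> only matters for the empty space, where the supremum would be unspecified.\<close>

definition sup_norm :: "'x topology \<Rightarrow> ('x \<Rightarrow> real) \<Rightarrow> real" where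
  "sup_norm K f = Sup (insert 0 ((\<lambda>x. \<bar>f x\<bar>) ` topspace K))"

text \<open>Topology of pointwise convergence on \<open>D\<close>, on a set \<open>V\<close> of functions.\<close>

definition pointwise_topology :: "('x \<Rightarrow> real) set \<Rightarrow> 'x set \<Rightarrow> ('x \<Rightarrow> real) topology" where
  "pointwise_topology V D =
     pullback_topology V (\<lambda>f. restrict f D) (product_topology (\<lambda>_. euclideanreal) D)"


section \<open>Norms on linear spaces of real functions\<close>

text \<open>Below, \<open>V\<close> is a linear space of real functions with the pointwise operations.\<close>

definition norm_on :: "('x \<Rightarrow> real) set \<Rightarrow> (('x \<Rightarrow> real) \<Rightarrow> real) \<Rightarrow> bool" where
  "norm_on V N \<longleftrightarrow>
     (\<forall>f\<in>V. 0 \<le> N f) \<and>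
     (\<forall>f\<in>V. N f = 0 \<longleftrightarrow> f = (\<lambda>_. 0)) \<and>
     (\<forall>f\<in>V. \<forall>c. N (\<lambda>x. c * f x) = \<bar>c\<bar> * N f) \<and>
     (\<forall>f\<in>V. \<forall>g\<in>V. N (\<lambda>x. f x + g x) \<le> N f + N g)"

definition equivalent_norms_on ::
  "('x \<Rightarrow> real) set \<Rightarrow> (('x \<Rightarrow> real) \<Rightarrow> real) \<Rightarrow> (('x \<Rightarrow> real) \<Rightarrow> real) \<Rightarrow> bool" where
  "equivalent_norms_on V N M \<longleftrightarrow>
     (\<exists>a>0. \<exists>b>0. \<forall>f\<in>V. a * M f \<le> N f \<and> N f \<le> b * M f)"

definition norm_topology ::
  "('x \<Rightarrow> real) set \<Rightarrow> (('x \<Rightarrow> real) \<Rightarrow> real) \<Rightarrow> ('x \<Rightarrow> real) topology" where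
  "norm_topology V N = Metric_space.mtopology V (\<lambda>f g. N (\<lambda>x. f x - g x))"

definition vector_topology_on :: "('x \<Rightarrow> real) set \<Rightarrow> ('x \<Rightarrow> real) topology \<Rightarrow> bool" where
  "vector_topology_on V T \<longleftrightarrow>
     topspace T = V \<and>
     continuous_map (prod_topology T T) T (\<lambda>(f, g). \<lambda>x. f x + g x) \<and>
     continuous_map (prod_topology euclideanreal T) T (\<lambda>(c, f). \<lambda>x. c * f x)"

text \<open>
  \<open>N\<close> is a \<open>T\<close>-Kadec norm on \<open>V\<close>. The requirements that \<open>T\<close> be a vector space topology
  weaker than the norm topology are part of the notion.
\<close>

definition Kadec_norm ::
  "('x \<Rightarrow> real) set \<Rightarrow> ('x \<Rightarrow> real) topology \<Rightarrow> (('x \<Rightarrow> real) \<Rightarrow> real) \<Rightarrow> bool" where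
  "Kadec_norm V T N \<longleftrightarrow>
     norm_on V N \<and>
     vector_topology_on V T \<and>
     (\<forall>U. openin T U \<longrightarrow> openin (norm_topology V N) U) \<and>
     subtopology (norm_topology V N) {f \<in> V. N f = 1} = subtopology T {f \<in> V. N f = 1}"

end

theory Submission
  imports Defs
begin

text \<open>
  The norm is a weighted sum of the seminorms \<open>P n\<close>, where \<open>P n f\<close> is the largest total oscillation
  \<open>\<Sum>\<^sub>j \<bar>f x\<^sub>j - f y\<^sub>j\<bar>\<close> over \<open>n\<close> pairs of points of the product of the \<open>D \<alpha>\<close> such that in every
  coordinate the intervals spanned by different pairs do not overlap. Each \<open>P n\<close> is lower
  semicontinuous for pointwise convergence, so on the unit sphere pointwise convergence
  \<open>g \<rightarrow> f\<close> forces \<open>P n g \<rightarrow> P n f\<close> for all \<open>n\<close>.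

  A continuous \<open>f\<close> oscillates by more than \<open>\<epsilon>\<close> only across finitely many cuts, so \<open>P n f\<close> grows
  sublinearly in \<open>n\<close> and some increment \<open>P (n + 2) f - P n f\<close> is arbitrarily small. Take \<open>n\<close>
  nearly optimal pairs for \<open>f\<close>. They are nearly optimal for \<open>g\<close> as well, even among families of \<open>n + 2\<close>
  pairs, so \<open>g\<close> cannot oscillate much away from these pairs, nor much more within one of them than \<open>f\<close>
  does. Applied once, this gives a finite set of coordinates that nearly determines all \<open>g\<close>;
  applied again with a smaller \<open>\<epsilon>\<close> to each of these coordinates, it gives a finite set of points
  that nearly determines all \<open>g\<close>, whence \<open>g \<rightarrow> f\<close> uniformly.
\<close>

section \<open>Linearly ordered spaces\<close>

lemma linear_order_onD:
  assumes "linear_order_on A R"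
  shows "\<And>a b. (a, b) \<in> R \<Longrightarrow> a \<in> A \<and> b \<in> A"
    and "\<And>a. a \<in> A \<Longrightarrow> (a, a) \<in> R"
    and "\<And>a b c. (a, b) \<in> R \<Longrightarrow> (b, c) \<in> R \<Longrightarrow> (a, c) \<in> R"
    and "\<And>a b. (a, b) \<in> R \<Longrightarrow> (b, a) \<in> R \<Longrightarrow> a = b"
    and "\<And>a b. a \<in> A \<Longrightarrow> b \<in> A \<Longrightarrow> (a, b) \<in> R \<or> (b, a) \<in> R"
proof -
  have *: "R \<subseteq> A \<times> A" "refl_on A R" "trans R" "antisym R" "total_on A R"
    using assms
    unfolding linear_order_on_def partial_order_on_def preorder_on_def by auto
  show "a \<in> A \<and> b \<in> A" if "(a, b) \<in> R" for a b using *(1) that by blast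
  show "(a, a) \<in> R" if "a \<in> A" for a using *(2) that by (rule refl_onD)
  show "(a, c) \<in> R" if "(a, b) \<in> R" "(b, c) \<in> R" for a b c using *(3) that by (rule transD)
  show "a = b" if "(a, b) \<in> R" "(b, a) \<in> R" for a b using *(4) that by (rule antisymD)
  show "(a, b) \<in> R \<or> (b, a) \<in> R" if "a \<in> A" "b \<in> A" for a b
    using *(2,5) that by (cases "a = b") (auto simp: total_on_def refl_on_def)
qed

lemma topspace_order_top [simp]: "topspace (order_top_of A R) = A"
  by (auto simp: order_top_of_def)

lemma openin_order_top_less:
  "a \<in> A \<Longrightarrow> openin (order_top_of A R) {x \<in> A. (x, a) \<in> R \<and> x \<noteq> a}"
  unfolding order_top_of_def by (rule topology_generated_by_Basis) blast

lemma openin_order_top_greater: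
  "a \<in> A \<Longrightarrow> openin (order_top_of A R) {x \<in> A. (a, x) \<in> R \<and> x \<noteq> a}"
  unfolding order_top_of_def by (rule topology_generated_by_Basis) blast

text \<open>Serves the duality between approximation from the right and from the left.\<close>

lemma order_top_converse: "order_top_of A (R\<inverse>) = order_top_of A R"
  by (simp add: order_top_of_def Un_commute Un_left_commute)

text \<open>Finite sets of lower and upper bounds replace the two endpoints of an open interval:
  they may be empty at the ends of the order, and intersecting two neighbourhoods simply unites
  them.\<close>

lemma order_top_nbhd:
  assumes "openin (order_top_of A R) U" "x \<in> U"
  shows "\<exists>B C. finite B \<and> B \<subseteq> A \<and> finite C \<and> C \<subseteq> A \<and>
           (\<forall>b\<in>B. (b, x) \<in> R \<and> b \<noteq> x) \<and> (\<forall>c\<in>C. (x, c) \<in> R \<and> c \<noteq> x) \<and>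
           (\<forall>y\<in>A. (\<forall>b\<in>B. (b, y) \<in> R \<and> b \<noteq> y) \<longrightarrow> (\<forall>c\<in>C. (y, c) \<in> R \<and> c \<noteq> y) \<longrightarrow> y \<in> U)"
    (is "\<exists>B C. ?P U B C")
proof -
  have "generate_topology_on ({A} \<union> {{x \<in> A. (x, a) \<in> R \<and> x \<noteq> a} | a. a \<in> A}
          \<union> {{x \<in> A. (a, x) \<in> R \<and> x \<noteq> a} | a. a \<in> A}) U"
    using assms(1) unfolding order_top_of_def by (rule openin_topology_generated_by)
  then show ?thesis
    using assms(2)
  proof induction
    case Empty
    then show ?case by simp
  next
    case (Int U V)
    then have "x \<in> U" "x \<in> V" by auto
    obtain B C where "?P U B C" using Int.IH(1)[OF \<open>x \<in> U\<close>] by (elim exE)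
    moreover obtain B' C' where "?P V B' C'" using Int.IH(2)[OF \<open>x \<in> V\<close>] by (elim exE)
    ultimately have "?P (U \<inter> V) (B \<union> B') (C \<union> C')"
      by (simp add: ball_Un)
    then show ?case by (intro exI)
  next
    case (UN \<U>)
    then obtain V where V: "V \<in> \<U>" "x \<in> V" by blast
    obtain B C where "?P V B C" using UN.IH[OF V] by (elim exE)
    with V(1) have "?P (\<Union>\<U>) B C" by (metis UnionI)
    then show ?case by (intro exI)
  next
    case (Basis V)
    then consider "V = A" | a where "a \<in> A" "V = {x \<in> A. (x, a) \<in> R \<and> x \<noteq> a}"
      | a where "a \<in> A" "V = {x \<in> A. (a, x) \<in> R \<and> x \<noteq> a}"
      by blast
    then show ?case
    proof cases
      case 1
      then have "?P V {} {}" by simp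
      then show ?thesis by blast
    next
      case (2 a)
      with Basis have "?P V {} {a}" by auto
      then show ?thesis by blast
    next
      case (3 a)
      with Basis have "?P V {a} {}" by auto
      then show ?thesis by blast
    qed
  qed
qed

lemma linear_order_finite_min:
  assumes "linear_order_on A R" "finite C" "C \<subseteq> A" "q \<in> A"
  shows "\<exists>m\<in>insert q C. \<forall>c\<in>insert q C. (m, c) \<in> R"
  using assms(2,3)
proof (induction C rule: finite_induct)
  case empty
  then show ?case using linear_order_onD(2)[OF assms(1)] assms(4) by blast
next
  case (insert c C)
  then obtain m where m: "m \<in> insert q C" "\<forall>c\<in>insert q C. (m, c) \<in> R" by auto
  note o = linear_order_onD[OF assms(1)]
  have "m \<in> A" "c \<in> A" using m insert assms(4) by auto
  then consider "(m, c) \<in> R" | "(c, m) \<in> R" using o(5) by blast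
  then show ?case
  proof cases
    case 1
    with m show ?thesis by blast
  next
    case 2
    then have "\<forall>c'\<in>insert q (insert c C). (c, c') \<in> R"
      using m(2) o(2)[OF \<open>c \<in> A\<close>] o(3) by (metis insert_iff)
    then show ?thesis by blast
  qed
qed

section \<open>One-sided approximation by points of the dense set\<close>

lemma dense_subset_ofD:
  assumes "dense_subset_of X D" "openin X U" "x \<in> U"
  shows "\<exists>d\<in>D. d \<in> U"
proof -
  have "x \<in> X closure_of D"
    using assms(1,3) openin_subset[OF assms(2)] unfolding dense_subset_of_def by auto
  then show ?thesis using assms(2,3) unfolding in_closure_of by blast
qed

text \<open>
  A point \<open>x\<close> that is not a limit from the right has an immediate successor or equals \<open>q\<close>; then it
  lies in \<open>D\<close>, and \<open>d = x\<close> works for a neighbourhood \<open>V\<close> that excludes the successor.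
\<close>

lemma dense_right_approx:
  assumes lin: "linear_order_on A R"
    and dense: "dense_subset_of (order_top_of A R) D"
    and adj: "contains_adjacent_pairs A R D"
    and U: "openin (order_top_of A R) U" "x \<in> U"
    and q: "q \<in> D" "(x, q) \<in> R"
  shows "\<exists>d V. d \<in> D \<and> d \<in> U \<and> (x, d) \<in> R \<and> (d, q) \<in> R \<and> openin (order_top_of A R) V \<and> x \<in> V \<and>
           (\<forall>y\<in>V. (y, q) \<in> R \<longrightarrow> (y, d) \<in> R)"
proof (cases "x = q")
  case True
  then show ?thesis using U q by blast
next
  case False
  note o = linear_order_onD[OF lin]
  have xq: "x \<in> A" "q \<in> A" using o(1) q(2) by auto
  obtain B C where "finite B \<and> B \<subseteq> A \<and> finite C \<and> C \<subseteq> A \<and>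
      (\<forall>b\<in>B. (b, x) \<in> R \<and> b \<noteq> x) \<and> (\<forall>c\<in>C. (x, c) \<in> R \<and> c \<noteq> x) \<and>
      (\<forall>y\<in>A. (\<forall>b\<in>B. (b, y) \<in> R \<and> b \<noteq> y) \<longrightarrow> (\<forall>c\<in>C. (y, c) \<in> R \<and> c \<noteq> y) \<longrightarrow> y \<in> U)"
    using order_top_nbhd[OF U] by (elim exE)
  then have BC: "finite C" "C \<subseteq> A" "\<forall>b\<in>B. (b, x) \<in> R \<and> b \<noteq> x"
      "\<forall>c\<in>C. (x, c) \<in> R \<and> c \<noteq> x"
      "\<And>y. \<lbrakk>y \<in> A; \<forall>b\<in>B. (b, y) \<in> R \<and> b \<noteq> y; \<forall>c\<in>C. (y, c) \<in> R \<and> c \<noteq> y\<rbrakk> \<Longrightarrow> y \<in> U"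
    by simp_all
  \<comment> \<open>The nearest among \<open>q\<close> and the upper bounds of the neighbourhood:
    whatever lies strictly between \<open>x\<close> and \<open>m\<close> stays in \<open>U\<close>
    and below \<open>q\<close>.\<close>
  obtain m where m: "m \<in> insert q C" "\<forall>c\<in>insert q C. (m, c) \<in> R"
    using linear_order_finite_min[OF lin BC(1,2) xq(2)] by blast
  have xm: "(x, m) \<in> R" "m \<noteq> x" "m \<in> A" "(m, q) \<in> R"
    using m BC q False xq by auto
  have sub: "y \<in> U" if "(x, y) \<in> R" "y \<noteq> x" "(y, m) \<in> R" "y \<noteq> m" for y
  proof (rule BC(5))
    show "y \<in> A" using that o(1) by blast
    show "\<forall>b\<in>B. (b, y) \<in> R \<and> b \<noteq> y" using BC(3) that o(3,4) by metis
    show "\<forall>c\<in>C. (y, c) \<in> R \<and> c \<noteq> y" using m(2) that o(3,4) by (metis insertCI)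
  qed
  show ?thesis
  proof (cases "\<exists>y. (x, y) \<in> R \<and> y \<noteq> x \<and> (y, m) \<in> R \<and> y \<noteq> m")
    case True
    then obtain y where y: "(x, y) \<in> R" "y \<noteq> x" "(y, m) \<in> R" "y \<noteq> m" by blast
    \<comment> \<open>The open interval from \<open>x\<close> to \<open>m\<close> is nonempty and so
      meets \<open>D\<close>; for such a \<open>d\<close> the open ray below \<open>d\<close> serves
      as \<open>V\<close>.\<close>
    have "openin (order_top_of A R)
        ({y \<in> A. (x, y) \<in> R \<and> y \<noteq> x} \<inter> {y \<in> A. (y, m) \<in> R \<and> y \<noteq> m})"
      using xq xm by (intro openin_Int openin_order_top_less openin_order_top_greater)
    with y o(1) obtain d where d: "d \<in> D" "(x, d) \<in> R" "d \<noteq> x" "(d, m) \<in> R" "d \<noteq> m"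
      using dense_subset_ofD[OF dense, of _ y] by blast
    then have "d \<in> A" using o(1) by blast
    show ?thesis
      using d sub[of d] openin_order_top_less[OF \<open>d \<in> A\<close>, of R] xq o(3)[OF d(4) xm(4)] by blast
  next
    case False
    then have "adjacent_in A R x m"
      unfolding adjacent_in_def strictly_between_def using xq xm o(3,4) by metis
    then have "x \<in> D" using adj unfolding contains_adjacent_pairs_def by blast
    moreover have "(y, x) \<in> R" if "y \<in> A" "(y, m) \<in> R" "y \<noteq> m" for y
      using that False o(2,5) xq by metis
    ultimately show ?thesis
      using U q xq xm o(2) openin_order_top_less[OF xm(3), of R] by blast
  qed
qed

text \<open>By duality: the converse order has the same topology and the same adjacent
  pairs.\<close>

lemma dense_left_approx:
  assumes lin: "linear_order_on A R"
    and dense: "dense_subset_of (order_top_of A R) D"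
    and adj: "contains_adjacent_pairs A R D"
    and U: "openin (order_top_of A R) U" "x \<in> U"
    and p: "p \<in> D" "(p, x) \<in> R"
  shows "\<exists>c V. c \<in> D \<and> c \<in> U \<and> (c, x) \<in> R \<and> (p, c) \<in> R \<and> openin (order_top_of A R) V \<and> x \<in> V \<and>
           (\<forall>y\<in>V. (p, y) \<in> R \<longrightarrow> (c, y) \<in> R)"
proof -
  have "contains_adjacent_pairs A (R\<inverse>) D"
    using adj by (simp add: contains_adjacent_pairs_def adjacent_in_def strictly_between_def) metis
  then show ?thesis
    using dense_right_approx[of A "R\<inverse>" D U x p] assms by (simp add: order_top_converse)
qed

section \<open>Finite enclosing sets from compactness\<close>

lemma compact_space_finite_cover:
  assumes "compact_space X" "\<And>x. x \<in> topspace X \<Longrightarrow> \<exists>U. openin X U \<and> x \<in> U \<and> Q U"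
  shows "\<exists>\<F>. finite \<F> \<and> (\<forall>U\<in>\<F>. Q U) \<and> topspace X \<subseteq> \<Union>\<F>"
proof -
  have "\<Union>{U. openin X U \<and> Q U} = topspace X"
    using assms(2) openin_subset by fast
  then obtain \<F> where "finite \<F>" "\<F> \<subseteq> {U. openin X U \<and> Q U}" "\<Union>\<F> = topspace X"
    using assms(1) unfolding compact_space by (metis (no_types, lifting) mem_Collect_eq)
  then show ?thesis by blast
qed

text \<open>
  Jumps of \<open>F\<close> between adjacent points are harmless, because these points can be put into \<open>W\<close>.
\<close>

lemma finite_enclosing_set:
  assumes lin: "linear_order_on A R"
    and compact: "compact_space (order_top_of A R)"
    and dense: "dense_subset_of (order_top_of A R) D"
    and adj: "contains_adjacent_pairs A R D"
    and F: "continuous_map (order_top_of A R) euclideanreal F"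
    and pq: "p \<in> D" "q \<in> D" and "0 < \<delta>"
  shows "\<exists>W. finite W \<and> W \<subseteq> D \<and> (\<forall>a\<in>D. (p, a) \<in> R \<longrightarrow> (a, q) \<in> R \<longrightarrow> a \<in> W \<or>
           (\<exists>c\<in>W. \<exists>d\<in>W. (p, c) \<in> R \<and> (c, a) \<in> R \<and> (a, d) \<in> R \<and> (d, q) \<in> R \<and> \<bar>F c - F d\<bar> < \<delta>))"
proof -
  let ?P = "\<lambda>W E. finite W \<and> W \<subseteq> D \<and> (\<forall>a\<in>E. (p, a) \<in> R \<longrightarrow> (a, q) \<in> R \<longrightarrow> a \<in> W \<or>
    (\<exists>c\<in>W. \<exists>d\<in>W. (p, c) \<in> R \<and> (c, a) \<in> R \<and> (a, d) \<in> R \<and> (d, q) \<in> R \<and> \<bar>F c - F d\<bar> < \<delta>))"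
  note o = linear_order_onD[OF lin]
  have D: "D \<subseteq> A" using dense unfolding dense_subset_of_def by simp
  have loc: "\<exists>V. openin (order_top_of A R) V \<and> x \<in> V \<and> (\<exists>W. ?P W (D \<inter> V))" if "x \<in> A" for x
  proof -
    \<comment> \<open>Near a point outside the interval from \<open>p\<close> to \<open>q\<close> an
      open ray makes the condition vacuous, and the empty \<open>W\<close> suffices there.\<close>
    consider "(x, p) \<in> R" "x \<noteq> p" | "(q, x) \<in> R" "x \<noteq> q" | "(p, x) \<in> R" "(x, q) \<in> R"
      using o(5)[of x p] o(5)[of x q] o(2) D pq \<open>x \<in> A\<close> by (metis subsetD)
    then show ?thesis
    proof cases
      case 1
      let ?V = "{x \<in> A. (x, p) \<in> R \<and> x \<noteq> p}"
      have "?P {} (D \<inter> ?V)" using o(4) by auto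
      then show ?thesis using 1 that openin_order_top_less[of p A R] pq D by blast
    next
      case 2
      let ?V = "{x \<in> A. (q, x) \<in> R \<and> x \<noteq> q}"
      have "?P {} (D \<inter> ?V)" using o(4) by auto
      then show ?thesis using 2 that openin_order_top_greater[of q A R] pq D by blast
    next
      case 3
      \<comment> \<open>Both approximating points come from \<open>U\<close>, where \<open>F\<close>
        stays within \<delta>/2 of \<open>F x\<close>, so their values differ by less than \<delta>.
        Every \<open>a\<close> in \<open>V \<inter> V'\<close> between \<open>p\<close> and
        \<open>q\<close> is enclosed by them.\<close>
      define U where "U = {y \<in> topspace (order_top_of A R). F y \<in> ball (F x) (\<delta> / 2)}"
      have U: "openin (order_top_of A R) U" "x \<in> U"
      proof -
        show "openin (order_top_of A R) U"
          unfolding U_def by (rule openin_continuous_map_preimage[OF F]) simp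
        show "x \<in> U" unfolding U_def using that \<open>0 < \<delta>\<close> by simp
      qed
      obtain d V where d: "d \<in> D" "d \<in> U" "(d, q) \<in> R" "openin (order_top_of A R) V" "x \<in> V"
          "\<forall>y\<in>V. (y, q) \<in> R \<longrightarrow> (y, d) \<in> R"
        using dense_right_approx[OF lin dense adj U pq(2) 3(2)] by blast
      obtain c V' where c: "c \<in> D" "c \<in> U" "(p, c) \<in> R" "openin (order_top_of A R) V'" "x \<in> V'"
          "\<forall>y\<in>V'. (p, y) \<in> R \<longrightarrow> (c, y) \<in> R"
        using dense_left_approx[OF lin dense adj U pq(1) 3(1)] by blast
      have "\<bar>F c - F d\<bar> < \<delta>"
        using c(2) d(2) unfolding U_def mem_Collect_eq mem_ball dist_real_def by linarith
      then have "?P {c, d} (D \<inter> (V \<inter> V'))" using c d by auto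
      then show ?thesis using c(4,5) d(4,5) by blast
    qed
  qed
  have "\<exists>\<F>. finite \<F> \<and> (\<forall>V\<in>\<F>. \<exists>W. ?P W (D \<inter> V)) \<and> topspace (order_top_of A R) \<subseteq> \<Union>\<F>"
    by (rule compact_space_finite_cover[OF compact]) (use loc in simp)
  then obtain \<F> where \<F>: "finite \<F>" "\<forall>V\<in>\<F>. \<exists>W. ?P W (D \<inter> V)" "A \<subseteq> \<Union>\<F>"
    by auto
  from bchoice[OF \<F>(2)] obtain W where W: "\<forall>V\<in>\<F>. ?P (W V) (D \<inter> V)" ..
  have "?P (\<Union>V\<in>\<F>. W V) D"
  proof (intro conjI ballI impI)
    fix a assume a: "a \<in> D" "(p, a) \<in> R" "(a, q) \<in> R"
    then obtain V where V: "V \<in> \<F>" "a \<in> D \<inter> V" using \<F>(3) D by blast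
    then have "W V \<subseteq> (\<Union>V\<in>\<F>. W V)" by blast
    moreover have "a \<in> W V \<or> (\<exists>c\<in>W V. \<exists>d\<in>W V. (p, c) \<in> R \<and> (c, a) \<in> R \<and> (a, d) \<in> R \<and> (d, q) \<in> R
        \<and> \<bar>F c - F d\<bar> < \<delta>)" using W V a by blast
    ultimately show "a \<in> (\<Union>V\<in>\<F>. W V) \<or> (\<exists>c\<in>(\<Union>V\<in>\<F>. W V). \<exists>d\<in>(\<Union>V\<in>\<F>. W V). (p, c) \<in> R \<and>
        (c, a) \<in> R \<and> (a, d) \<in> R \<and> (d, q) \<in> R \<and> \<bar>F c - F d\<bar> < \<delta>)"
      by (meson subsetD)
  qed (use \<F>(1) W in auto)
  then show ?thesis by blast
qed

section \<open>Kadec norms from sequences of seminorms\<close>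

lemma cont_functionsD:
  assumes "f \<in> cont_functions K"
  shows "continuous_map K euclideanreal f" "\<And>x. x \<notin> topspace K \<Longrightarrow> f x = 0"
  using assms by (auto simp: cont_functions_def)

lemma cont_functions_add:
  "\<lbrakk>f \<in> cont_functions K; g \<in> cont_functions K\<rbrakk> \<Longrightarrow> (\<lambda>x. f x + g x) \<in> cont_functions K"
  by (simp add: cont_functions_def continuous_map_add)

lemma cont_functions_diff:
  "\<lbrakk>f \<in> cont_functions K; g \<in> cont_functions K\<rbrakk> \<Longrightarrow> (\<lambda>x. f x - g x) \<in> cont_functions K"
  by (simp add: cont_functions_def continuous_map_diff)

lemma cont_functions_scale:
  "f \<in> cont_functions K \<Longrightarrow> (\<lambda>x. c * f x) \<in> cont_functions K"
  by (simp add: cont_functions_def continuous_map_real_mult_left)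

lemma cont_functions_zero: "(\<lambda>x. 0) \<in> cont_functions K"
  by (simp add: cont_functions_def)

text \<open>No restriction on \<open>x\<close> is needed: representatives vanish outside the space,
  and 0 takes part in the supremum.\<close>

lemma abs_le_sup_norm:
  assumes "compact_space K" "f \<in> cont_functions K"
  shows "\<bar>f x\<bar> \<le> sup_norm K f"
proof -
  have "compactin euclideanreal (f ` topspace K)"
    using assms by (intro image_compactin) (auto simp: cont_functionsD compact_space_def)
  then have "bounded (f ` topspace K)"
    using compact_imp_bounded by auto
  then obtain B where "\<And>y. y \<in> topspace K \<Longrightarrow> \<bar>f y\<bar> \<le> B"
    unfolding bounded_iff by auto
  then have bdd: "bdd_above (insert 0 ((\<lambda>x. \<bar>f x\<bar>) ` topspace K))"
    by (auto intro!: bdd_aboveI2)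
  show ?thesis
  proof (cases "x \<in> topspace K")
    case True
    then show ?thesis
      unfolding sup_norm_def by (intro cSup_upper[OF _ bdd]) auto
  next
    case False
    then have "f x = 0" using cont_functionsD(2)[OF assms(2)] by blast
    then show ?thesis
      unfolding sup_norm_def by (intro cSup_upper[OF _ bdd]) auto
  qed
qed

lemma sup_norm_leI:
  assumes "0 \<le> c" "\<And>x. x \<in> topspace K \<Longrightarrow> \<bar>f x\<bar> \<le> c"
  shows "sup_norm K f \<le> c"
  unfolding sup_norm_def by (intro cSup_least) (use assms in auto)

lemma sup_norm_nonneg:
  assumes "compact_space K" "f \<in> cont_functions K"
  shows "0 \<le> sup_norm K f"
  using abs_le_sup_norm[OF assms] by (rule order_trans[OF abs_ge_zero])

lemma sup_norm_eq_0D: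
  assumes "compact_space K" "f \<in> cont_functions K" "sup_norm K f \<le> 0"
  shows "f = (\<lambda>x. 0)"
proof
  fix x show "f x = 0" using abs_le_sup_norm[OF assms(1,2), of x] assms(3) by linarith
qed

section \<open>The topology of pointwise convergence\<close>

lemma topspace_pointwise_topology [simp]: "topspace (pointwise_topology V D) = V"
  by (auto simp: pointwise_topology_def topspace_pullback_topology)

lemma continuous_map_pointwise_eval:
  assumes "x \<in> D"
  shows "continuous_map (pointwise_topology V D) euclideanreal (\<lambda>f. f x)"
proof -
  have "continuous_map (pointwise_topology V D) euclideanreal
      ((\<lambda>h. h x) \<circ> (\<lambda>f. restrict f D))"
    unfolding pointwise_topology_def
    using assms by (intro continuous_map_pullback continuous_map_product_projection)
  then show ?thesis using assms by (simp add: o_def)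
qed

lemma continuous_map_into_pointwise:
  assumes "\<And>z. z \<in> topspace Z \<Longrightarrow> h z \<in> V"
    and "\<And>x. x \<in> D \<Longrightarrow> continuous_map Z euclideanreal (\<lambda>z. h z x)"
  shows "continuous_map Z (pointwise_topology V D) h"
  unfolding pointwise_topology_def
proof (rule continuous_map_pullback')
  show "continuous_map Z (product_topology (\<lambda>_. euclideanreal) D) ((\<lambda>f. restrict f D) \<circ> h)"
    using assms(2) by (auto simp: continuous_map_componentwise)
qed (use assms(1) in auto)

lemma vector_topology_pointwise:
  assumes add: "\<And>f g. f \<in> V \<Longrightarrow> g \<in> V \<Longrightarrow> (\<lambda>x. f x + g x) \<in> V"
    and scale: "\<And>c f. f \<in> V \<Longrightarrow> (\<lambda>x. c * f x) \<in> V"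
  shows "vector_topology_on V (pointwise_topology V D)"
  unfolding vector_topology_on_def
proof (intro conjI)
  let ?T = "pointwise_topology V D"
  have fst: "continuous_map (prod_topology Y ?T) euclideanreal (\<lambda>z. snd z x)" if "x \<in> D"
    for Y :: "'z topology" and x
    using continuous_map_compose[OF continuous_map_snd continuous_map_pointwise_eval[OF that, of V], of Y]
    by (simp add: o_def)
  have snd: "continuous_map (prod_topology ?T Y) euclideanreal (\<lambda>z. fst z x)" if "x \<in> D"
    for Y :: "'z topology" and x
    using continuous_map_compose[OF continuous_map_fst continuous_map_pointwise_eval[OF that, of V], of Y]
    by (simp add: o_def)
  show "continuous_map (prod_topology ?T ?T) ?T (\<lambda>(f, g) x. f x + g x)"
    by (rule continuous_map_into_pointwise)
      (auto simp: case_prod_unfold intro!: add continuous_map_add fst snd)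
  show "continuous_map (prod_topology euclideanreal ?T) ?T (\<lambda>(c, f) x. c * f x)"
    by (rule continuous_map_into_pointwise)
      (auto simp: case_prod_unfold intro!: scale continuous_map_real_mult fst continuous_map_fst)
qed simp

lemma tendsto_nhdsin_continuous_map:
  assumes "continuous_map X euclideanreal h" "a \<in> topspace X"
  shows "(h \<longlongrightarrow> h a) (nhdsin X a)"
proof (rule topological_tendstoI)
  fix S :: "real set" assume "open S" "h a \<in> S"
  moreover from this have "openin X {y \<in> topspace X. h y \<in> S}"
    by (intro openin_continuous_map_preimage[OF assms(1)]) simp
  ultimately show "\<forall>\<^sub>F y in nhdsin X a. h y \<in> S"
    using assms(2) unfolding eventually_nhdsin by blast
qed

section \<open>Norm topologies and the Kadec property\<close>

lemma norm_onD:
  assumes "norm_on V N"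
  shows "\<And>f. f \<in> V \<Longrightarrow> 0 \<le> N f"
    and "\<And>f. f \<in> V \<Longrightarrow> N f = 0 \<longleftrightarrow> f = (\<lambda>_. 0)"
    and "\<And>f c. f \<in> V \<Longrightarrow> N (\<lambda>x. c * f x) = \<bar>c\<bar> * N f"
    and "\<And>f g. f \<in> V \<Longrightarrow> g \<in> V \<Longrightarrow> N (\<lambda>x. f x + g x) \<le> N f + N g"
  using assms by (simp_all add: norm_on_def)

text \<open>The normalisation \<open>outside\<close> is there because a \<open>Metric_space\<close>
  asks for nonnegativity and symmetry of the distance off its carrier too, where
  \<open>norm_on\<close> gives no information.\<close>

locale norm_on_functions =
  fixes V :: "('x \<Rightarrow> real) set" and N :: "('x \<Rightarrow> real) \<Rightarrow> real"
  assumes norm_on: "norm_on V N"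
    and diff: "\<And>f g. f \<in> V \<Longrightarrow> g \<in> V \<Longrightarrow> (\<lambda>x. f x - g x) \<in> V"
    and scale: "\<And>c f. f \<in> V \<Longrightarrow> (\<lambda>x. c * f x) \<in> V"
    and outside: "\<And>f. f \<notin> V \<Longrightarrow> N f = 0"
begin

lemma N_minus: "N (\<lambda>x. g x - f x) = N (\<lambda>x. f x - g x)"
proof -
  have eq: "(\<lambda>x. g x - f x) = (\<lambda>x. - 1 * (f x - g x))"
    "(\<lambda>x. f x - g x) = (\<lambda>x. - 1 * (g x - f x))" for f g :: "'x \<Rightarrow> real"
    by auto
  have *: "(\<lambda>x. g x - f x) \<in> V" if "(\<lambda>x. f x - g x) \<in> V" for f g
    by (subst eq(1)) (rule scale[OF that])
  show ?thesis
  proof (cases "(\<lambda>x. f x - g x) \<in> V")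
    case True
    then have "N (\<lambda>x. - 1 * (f x - g x)) = \<bar>- 1\<bar> * N (\<lambda>x. f x - g x)"
      by (rule norm_onD(3)[OF norm_on])
    then show ?thesis by (subst eq(1)) simp
  next
    case False
    then have "(\<lambda>x. g x - f x) \<notin> V" using * by blast
    then show ?thesis using False outside by simp
  qed
qed

sublocale Metric_space V "\<lambda>f g. N (\<lambda>x. f x - g x)"
proof
  show "0 \<le> N (\<lambda>x. f x - g x)" for f g
    using outside[of "\<lambda>x. f x - g x"] norm_onD(1)[OF norm_on, of "\<lambda>x. f x - g x"]
    by (cases "(\<lambda>x. f x - g x) \<in> V") auto
  show "N (\<lambda>x. f x - g x) = N (\<lambda>x. g x - f x)" for f g
    by (rule N_minus)
  show "(N (\<lambda>x. f x - g x) = 0) = (f = g)" if "f \<in> V" "g \<in> V" for f g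
    using norm_onD(2)[OF norm_on diff[OF that]] by (auto simp: fun_eq_iff)
  show "N (\<lambda>x. f x - h x) \<le> N (\<lambda>x. f x - g x) + N (\<lambda>x. g x - h x)"
    if "f \<in> V" "g \<in> V" "h \<in> V" for f g h
  proof -
    have "N (\<lambda>x. (f x - g x) + (g x - h x)) \<le> N (\<lambda>x. f x - g x) + N (\<lambda>x. g x - h x)"
      by (rule norm_onD(4)[OF norm_on diff[OF that(1,2)] diff[OF that(2,3)]])
    then show ?thesis by simp
  qed
qed

text \<open>Turns equality of two topologies on the sphere into convergence along filters. By
  \<open>eval\<close>, evaluations at points of \<open>D\<close> are norm continuous, so the
  pointwise topology is weaker. The condition \<open>principal {f} \<le> F\<close> says that
  whatever holds eventually along \<open>F\<close> holds for \<open>f\<close> itself.\<close>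

lemma Kadec_norm_pointwiseI:
  assumes add: "\<And>f g. f \<in> V \<Longrightarrow> g \<in> V \<Longrightarrow> (\<lambda>x. f x + g x) \<in> V"
    and eval: "\<And>f x. f \<in> V \<Longrightarrow> x \<in> D \<Longrightarrow> \<bar>f x\<bar> \<le> b * N f"
    and conv: "\<And>f F \<epsilon>. \<lbrakk>f \<in> V; \<forall>\<^sub>F g in F. g \<in> V; \<forall>x\<in>D. ((\<lambda>g. g x) \<longlongrightarrow> f x) F;
        \<forall>\<^sub>F g in F. N g = N f; principal {f} \<le> F; 0 < \<epsilon>\<rbrakk> \<Longrightarrow> \<forall>\<^sub>F g in F. N (\<lambda>x. f x - g x) < \<epsilon>"
  shows "Kadec_norm V (pointwise_topology V D) N"
proof -
  let ?T = "pointwise_topology V D" and ?S = "{f \<in> V. N f = 1}"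
  have nt: "norm_topology V N = mtopology"
    by (simp add: norm_topology_def)
  have "continuous_map mtopology euclideanreal (\<lambda>f. f x)" if "x \<in> D" for x
  proof -
    have "\<exists>\<delta>>0. \<forall>g. g \<in> V \<and> N (\<lambda>x. f x - g x) < \<delta> \<longrightarrow> dist (f x) (g x) < \<epsilon>"
      if f: "f \<in> V" and "0 < \<epsilon>" for f \<epsilon>
    proof (intro exI conjI allI impI)
      \<comment> \<open>The summand 1 keeps the radius positive even for
        \<open>b = 0\<close>.\<close>
      show "0 < \<epsilon> / (\<bar>b\<bar> + 1)" using \<open>0 < \<epsilon>\<close> by simp
      fix g assume g: "g \<in> V \<and> N (\<lambda>x. f x - g x) < \<epsilon> / (\<bar>b\<bar> + 1)"
      then have "\<bar>f x - g x\<bar> \<le> b * N (\<lambda>x. f x - g x)"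
        using eval[OF diff[OF f] \<open>x \<in> D\<close>] by blast
      also have "\<dots> \<le> (\<bar>b\<bar> + 1) * N (\<lambda>x. f x - g x)"
        by (intro mult_right_mono) auto
      also have "\<dots> < \<epsilon>"
        using g by (simp add: pos_less_divide_eq mult.commute)
      finally show "dist (f x) (g x) < \<epsilon>" by (simp add: dist_real_def)
    qed
    then show ?thesis
      by (simp add: metric_continuous_map[of UNIV dist, simplified] Met_TC.Metric_space_axioms)
  qed
  then have "continuous_map mtopology ?T id"
    by (intro continuous_map_into_pointwise) auto
  then have weaker: "openin mtopology U" if "openin ?T U" for U
  proof -
    have "openin mtopology {f \<in> V. id f \<in> U}"
      using openin_continuous_map_preimage[OF \<open>continuous_map mtopology ?T id\<close> that] by simp
    moreover have "{f \<in> V. id f \<in> U} = U"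
      using openin_subset[OF that] by auto
    ultimately show ?thesis by simp
  qed
  have "openin (subtopology ?T ?S) U" if U: "openin (subtopology mtopology ?S) U" for U
  proof (rule iffD2[OF openin_subopen], rule ballI)
    obtain W where W: "openin mtopology W" "U = W \<inter> ?S"
      using U unfolding openin_subtopology by blast
    fix f assume "f \<in> U"
    then have f: "f \<in> V" "N f = 1" "f \<in> W" using W by auto
    obtain \<epsilon> where \<epsilon>: "0 < \<epsilon>" "mball f \<epsilon> \<subseteq> W"
      using W(1) f(3) by (auto simp only: openin_mtopology)
    \<comment> \<open>The pointwise neighbourhoods of \<open>f\<close>, traced on the unit sphere;
      the norm is constant along this filter.\<close>
    let ?F = "inf (nhdsin ?T f) (principal ?S)"
    have "\<forall>\<^sub>F g in ?F. N (\<lambda>x. f x - g x) < \<epsilon>"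
    proof (rule conv)
      show "\<forall>x\<in>D. ((\<lambda>g. g x) \<longlongrightarrow> f x) ?F"
        by (intro ballI tendsto_mono[OF inf_le1]
            tendsto_nhdsin_continuous_map[OF continuous_map_pointwise_eval]) (use f in auto)
      show "\<forall>\<^sub>F g in ?F. g \<in> V" "\<forall>\<^sub>F g in ?F. N g = N f"
        using f by (auto simp: eventually_inf_principal)
      show "principal {f} \<le> ?F"
        using f by (auto simp: le_filter_def eventually_inf_principal eventually_nhdsin
            eventually_principal)
    qed (use f \<epsilon> in auto)
    then have "\<forall>\<^sub>F g in nhdsin ?T f. g \<in> ?S \<longrightarrow> g \<in> W"
      unfolding eventually_inf_principal
      by (rule eventually_mono) (use \<epsilon>(2) f in auto)
    then obtain G where G: "openin ?T G" "f \<in> G" "\<forall>g\<in>G. g \<in> ?S \<longrightarrow> g \<in> W"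
      using f unfolding eventually_nhdsin by auto
    then have "openin (subtopology ?T ?S) (G \<inter> ?S)" "f \<in> G \<inter> ?S" "G \<inter> ?S \<subseteq> U"
      using f W(2) by (auto simp: openin_subtopology)
    then show "\<exists>T. openin (subtopology ?T ?S) T \<and> f \<in> T \<and> T \<subseteq> U" by blast
  qed
  then have "subtopology mtopology ?S = subtopology ?T ?S"
    unfolding topology_eq using weaker by (auto simp: openin_subtopology)
  then show ?thesis
    unfolding Kadec_norm_def nt
    using norm_on weaker vector_topology_pointwise[OF add scale] by blast
qed

end

text \<open>
  Lower semicontinuity forces each summand to converge along with the sum
  \<open>N f = (\<Sum>k. (1 / 2) ^ k / B k * P k f)\<close>.
\<close>

lemma Kadec_norm_of_seminorms:
  fixes K :: "'x topology" and P :: "nat \<Rightarrow> ('x \<Rightarrow> real) \<Rightarrow> real" and B :: "nat \<Rightarrow> real"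
  defines "V \<equiv> cont_functions K"
  assumes K: "compact_space K" and D: "D \<subseteq> topspace K"
    and P_nonneg: "\<And>k f. f \<in> V \<Longrightarrow> 0 \<le> P k f"
    and P_scale: "\<And>k f c. f \<in> V \<Longrightarrow> P k (\<lambda>x. c * f x) = \<bar>c\<bar> * P k f"
    and P_add: "\<And>k f g. f \<in> V \<Longrightarrow> g \<in> V \<Longrightarrow> P k (\<lambda>x. f x + g x) \<le> P k f + P k g"
    and B: "\<And>k. 0 < B k" "\<And>k f. f \<in> V \<Longrightarrow> P k f \<le> B k * sup_norm K f"
    and lower: "\<And>f. f \<in> V \<Longrightarrow> sup_norm K f \<le> P 1 f"
    and lsc: "\<And>k f F c. \<lbrakk>f \<in> V; \<forall>\<^sub>F g in F. g \<in> V; \<forall>x\<in>D. ((\<lambda>g. g x) \<longlongrightarrow> f x) F; c < P k f\<rbrakk>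
        \<Longrightarrow> \<forall>\<^sub>F g in F. c < P k g"
    and conv: "\<And>f F \<epsilon>. \<lbrakk>f \<in> V; \<forall>\<^sub>F g in F. g \<in> V; \<forall>x\<in>D. ((\<lambda>g. g x) \<longlongrightarrow> f x) F;
        \<And>k \<eta>. 0 < \<eta> \<Longrightarrow> \<forall>\<^sub>F g in F. P k g < P k f + \<eta>; principal {f} \<le> F; 0 < \<epsilon>\<rbrakk>
        \<Longrightarrow> \<forall>\<^sub>F g in F. sup_norm K (\<lambda>x. f x - g x) \<le> \<epsilon>"
  shows "\<exists>N. norm_on V N \<and> equivalent_norms_on V N (sup_norm K) \<and>
           Kadec_norm V (pointwise_topology V D) N"
proof -
  define w :: "nat \<Rightarrow> real" where "w k = (1 / 2) ^ k / B k" for k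
  \<comment> \<open>The value 0 outside \<open>V\<close> is what \<open>norm_on_functions\<close>
    demands.\<close>
  define N where "N f = (if f \<in> V then (\<Sum>k. w k * P k f) else 0)" for f
  have w: "0 < w k" for k using B(1) by (simp add: w_def)
  have term_le: "w k * P k f \<le> (1 / 2) ^ k * sup_norm K f" if "f \<in> V" for k f
    using mult_left_mono[OF B(2)[OF that, of k] less_imp_le[OF w[of k]]] B(1)[of k]
    by (simp add: w_def)
  have term_nonneg: "0 \<le> w k * P k f" if "f \<in> V" for k f
    using w[of k] P_nonneg[OF that, of k] by simp
  have geo: "(\<lambda>k. (1 / 2) ^ k * sup_norm K f) sums (2 * sup_norm K f)" for f
    using sums_mult2[OF geometric_sums[of "1 / 2 :: real"], of "sup_norm K f"] by simp
  have summ: "summable (\<lambda>k. w k * P k f)" if "f \<in> V" for f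
    by (rule summable_comparison_test'[OF sums_summable[OF geo[of f]], of 0])
      (use term_le[OF that] term_nonneg[OF that] in simp)
  have N_upper: "N f \<le> 2 * sup_norm K f" if "f \<in> V" for f
  proof -
    have "N f \<le> (\<Sum>k. (1 / 2) ^ k * sup_norm K f)"
      unfolding N_def using that
      by (auto intro!: suminf_le term_le summ sums_summable[OF geo])
    then show ?thesis using sums_unique[OF geo[of f]] by simp
  qed
  have N_sum: "(\<Sum>k\<in>J. w k * P k f) \<le> N f" if "f \<in> V" "finite J" for J f
    using that sum_le_suminf[OF summ[OF that(1)] that(2)] term_nonneg[OF that(1)]
    by (simp add: N_def)
  have N_lower: "w 1 * sup_norm K f \<le> N f" if "f \<in> V" for f
  proof -
    have "w 1 * sup_norm K f \<le> w 1 * P 1 f"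
      using lower[OF that] w[of 1] by (intro mult_left_mono) auto
    then show ?thesis using N_sum[OF that, of "{1}"] by simp
  qed
  have sup0: "0 \<le> sup_norm K f" if "f \<in> V" for f
    using sup_norm_nonneg[OF K] that unfolding V_def by blast
  have V: "(\<lambda>x. f x + g x) \<in> V" "(\<lambda>x. f x - g x) \<in> V" "(\<lambda>x. c * f x) \<in> V"
    if "f \<in> V" "g \<in> V" for f g c
    using that unfolding V_def
    by (auto intro: cont_functions_add cont_functions_diff cont_functions_scale)
  have N_scale: "N (\<lambda>x. c * f x) = \<bar>c\<bar> * N f" if "f \<in> V" for f c
    using that V(3)[OF that that] P_scale[OF that] suminf_mult[OF summ[OF that], of "\<bar>c\<bar>"]
    by (simp add: N_def mult.left_commute)
  have norm: "norm_on V N"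
    unfolding norm_on_def
  proof (intro conjI ballI allI)
    fix f assume f: "f \<in> V"
    show "0 \<le> N f" using N_sum[OF f, of "{}"] by simp
    show "N f = 0 \<longleftrightarrow> f = (\<lambda>_. 0)"
    proof
      assume "N f = 0"
      then have "w 1 * sup_norm K f \<le> 0" using N_lower[OF f] by simp
      then have "sup_norm K f \<le> 0" using w[of 1] by (simp add: mult_le_0_iff)
      then show "f = (\<lambda>_. 0)" using sup_norm_eq_0D[OF K] f unfolding V_def by blast
    next
      assume "f = (\<lambda>_. 0)"
      then show "N f = 0" using N_scale[OF f, of 0] by simp
    qed
    show "N (\<lambda>x. c * f x) = \<bar>c\<bar> * N f" for c by (rule N_scale[OF f])
    fix g assume g: "g \<in> V"
    have "(\<Sum>k. w k * P k (\<lambda>x. f x + g x)) \<le> (\<Sum>k. w k * P k f + w k * P k g)"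
    proof (rule suminf_le[OF _ summ[OF V(1)[OF f g]] summable_add[OF summ[OF f] summ[OF g]]])
      show "w k * P k (\<lambda>x. f x + g x) \<le> w k * P k f + w k * P k g" for k
        using mult_left_mono[OF P_add[OF f g, of k] less_imp_le[OF w[of k]]]
        by (simp add: distrib_left)
    qed
    then have "N (\<lambda>x. f x + g x) \<le> (\<Sum>k. w k * P k f + w k * P k g)"
      using V(1)[OF f g] by (simp add: N_def)
    also have "\<dots> = N f + N g"
      using f g by (simp add: N_def suminf_add[OF summ summ])
    finally show "N (\<lambda>x. f x + g x) \<le> N f + N g" .
  qed
  interpret norm_on_functions V N
    by unfold_locales (use norm V in \<open>auto simp: N_def\<close>)
  have P_conv: "\<forall>\<^sub>F g in F. P k g < P k f + \<eta>"
    if f: "f \<in> V" and F: "\<forall>\<^sub>F g in F. g \<in> V" "\<forall>x\<in>D. ((\<lambda>g. g x) \<longlongrightarrow> f x) F"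
      "\<forall>\<^sub>F g in F. N g = N f" and "0 < \<eta>" for f F k \<eta>
  proof -
    \<comment> \<open>Since \<open>N g = N f\<close>, an excess of the term with index
      \<open>k\<close> must be balanced by a loss elsewhere. Two losses of size \<open>t\<close> are
      allowed: the tail of the series for \<open>f\<close>, and the drop of the other terms of index
      below \<open>m\<close>. Together they amount to \<open>w k * \<eta>\<close>.\<close>
    define t where "t = w k * \<eta> / 2"
    have "0 < t" using w[of k] \<open>0 < \<eta>\<close> by (simp add: t_def)
    have "(\<lambda>n. \<Sum>j<n. w j * P j f) \<longlonglongrightarrow> N f"
      using summable_LIMSEQ[OF summ[OF f]] f by (simp add: N_def)
    then have "\<forall>\<^sub>F n in sequentially. N f - t < (\<Sum>j<n. w j * P j f)"
      using \<open>0 < t\<close> by (intro order_tendstoD(1)) auto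
    then obtain m where "N f - t < (\<Sum>j<m. w j * P j f)" "k < m"
      using eventually_conj[OF _ eventually_gt_at_top[of k]]
      by (metis (mono_tags, lifting) eventually_happens trivial_limit_sequentially)
    moreover have split: "(\<Sum>j<m. w j * P j g) = w k * P k g + (\<Sum>j\<in>{..<m} - {k}. w j * P j g)" for g
      using \<open>k < m\<close> by (intro sum.remove) auto
    ultimately have m: "N f - t < w k * P k f + (\<Sum>j\<in>{..<m} - {k}. w j * P j f)" by simp
    \<comment> \<open>In the weighted sum a drop of \<open>t / (m * w j)\<close> costs
      \<open>t / m\<close>, hence at most \<open>t\<close> over all \<open>m\<close> terms.\<close>
    have "\<forall>\<^sub>F g in F. \<forall>j\<in>{..<m}. P j f - t / (m * w j) < P j g"
      unfolding eventually_ball_finite_distrib[OF finite_lessThan]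
    proof
      fix j assume "j \<in> {..<m}"
      then have "0 < t / (m * w j)" using \<open>0 < t\<close> w[of j] by simp
      then show "\<forall>\<^sub>F g in F. P j f - t / (m * w j) < P j g"
        by (intro lsc[OF f F(1,2)]) simp
    qed
    then show ?thesis
      using F(1,3)
    proof eventually_elim
      case (elim g)
      have "w j * P j f - t / m \<le> w j * P j g" if "j < m" for j
      proof -
        have "w j * (P j f - t / (m * w j)) \<le> w j * P j g"
          using elim(1) that w[of j] by (intro mult_left_mono) (auto intro: less_imp_le)
        moreover have "w j * (t / (m * w j)) = t / m" using w[of j] by simp
        ultimately show ?thesis by (simp add: right_diff_distrib)
      qed
      then have "(\<Sum>j\<in>{..<m} - {k}. w j * P j f - t / m) \<le> (\<Sum>j\<in>{..<m} - {k}. w j * P j g)"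
        by (intro sum_mono) auto
      moreover have "(\<Sum>j\<in>{..<m} - {k}. t / m) \<le> (\<Sum>j<m. t / m)"
        using \<open>0 < t\<close> by (intro sum_mono2) auto
      moreover have "(\<Sum>j<m. t / m) = t" using \<open>k < m\<close> by simp
      ultimately have "(\<Sum>j\<in>{..<m} - {k}. w j * P j f) - t \<le> (\<Sum>j\<in>{..<m} - {k}. w j * P j g)"
        by (simp add: sum_subtractf)
      moreover have "w k * P k g + (\<Sum>j\<in>{..<m} - {k}. w j * P j g) \<le> N f"
        using N_sum[OF elim(2), of "{..<m}"] split[of g] elim(3) by simp
      ultimately have "w k * P k g < w k * P k f + 2 * t" using m by linarith
      then have "w k * P k g < w k * (P k f + \<eta>)" by (simp add: t_def distrib_left)
      then show ?case using w[of k] by simp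
    qed
  qed
  have "Kadec_norm V (pointwise_topology V D) N"
  proof (rule Kadec_norm_pointwiseI)
    show "(\<lambda>x. f x + g x) \<in> V" if "f \<in> V" "g \<in> V" for f g using V(1) that .
    show "\<bar>f x\<bar> \<le> 1 / w 1 * N f" if "f \<in> V" "x \<in> D" for f x
    proof -
      have "\<bar>f x\<bar> \<le> sup_norm K f"
        using abs_le_sup_norm[OF K] that unfolding V_def by blast
      also have "\<dots> \<le> 1 / w 1 * N f"
        using N_lower[OF that(1)] w[of 1] by (simp add: field_simps)
      finally show ?thesis .
    qed
    show "\<forall>\<^sub>F g in F. N (\<lambda>x. f x - g x) < \<epsilon>"
      if f: "f \<in> V" and F: "\<forall>\<^sub>F g in F. g \<in> V" "\<forall>x\<in>D. ((\<lambda>g. g x) \<longlongrightarrow> f x) F"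
        "\<forall>\<^sub>F g in F. N g = N f" and "principal {f} \<le> F" "0 < \<epsilon>" for f F \<epsilon>
    proof -
      \<comment> \<open>As \<open>N\<close> is at most twice the supremum norm, \<epsilon>/4 leaves
        a strict inequality.\<close>
      have "\<forall>\<^sub>F g in F. sup_norm K (\<lambda>x. f x - g x) \<le> \<epsilon> / 4"
        by (rule conv[OF f F(1,2) P_conv[OF f F]]) (use that in auto)
      then show ?thesis
        using F(1)
      proof eventually_elim
        case (elim g)
        then show ?case using N_upper[OF V(2)[OF f elim(2)]] \<open>0 < \<epsilon>\<close> by linarith
      qed
    qed
  qed
  moreover have "equivalent_norms_on V N (sup_norm K)"
    unfolding equivalent_norms_on_def
    by (rule exI[of _ "w 1"], rule conjI[OF w], rule exI[of _ 2])
      (use N_upper N_lower in auto)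
  ultimately show ?thesis using norm by blast
qed

section \<open>Oscillation over products of linearly ordered spaces\<close>

locale ordered_product =
  fixes I :: "'i set"
    and L :: "'i \<Rightarrow> 'a set"
    and r :: "'i \<Rightarrow> ('a \<times> 'a) set"
    and D :: "'i \<Rightarrow> 'a set"
    and e :: "'i \<Rightarrow> 'a"
  assumes lin: "\<And>\<alpha>. \<alpha> \<in> I \<Longrightarrow> linear_order_on (L \<alpha>) (r \<alpha>)"
    and compact: "\<And>\<alpha>. \<alpha> \<in> I \<Longrightarrow> compact_space (order_top_of (L \<alpha>) (r \<alpha>))"
    and dense: "\<And>\<alpha>. \<alpha> \<in> I \<Longrightarrow> dense_subset_of (order_top_of (L \<alpha>) (r \<alpha>)) (D \<alpha>)"
    and adj: "\<And>\<alpha>. \<alpha> \<in> I \<Longrightarrow> contains_adjacent_pairs (L \<alpha>) (r \<alpha>) (D \<alpha>)"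
    and e: "e \<in> (\<Pi>\<^sub>E \<alpha>\<in>I. D \<alpha>)"
begin

abbreviation "K \<equiv> product_topology (\<lambda>\<alpha>. order_top_of (L \<alpha>) (r \<alpha>)) I"

text \<open>Restricting to finite modifications of the base point \<open>e\<close> keeps density,
  and makes any two points differ in only finitely many coordinates.\<close>

definition D0 :: "('i \<Rightarrow> 'a) set" where
  "D0 = {x \<in> (\<Pi>\<^sub>E \<alpha>\<in>I. D \<alpha>). finite {\<alpha> \<in> I. x \<alpha> \<noteq> e \<alpha>}}"

text \<open>
  A cut \<open>(\<alpha>, C)\<close> is an initial segment \<open>C\<close> of the \<open>\<alpha>\<close>-th factor. Two pairs of points have disjoint
  \<open>cuts\<close> iff in every coordinate the intervals spanned by the two pairs do not overlap. The summand
  \<open>\<bar>f e\<bar>\<close> of \<open>total_osc\<close> makes \<open>P 1\<close> dominate the supremum norm.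
\<close>

definition cuts :: "('i \<Rightarrow> 'a) \<times> ('i \<Rightarrow> 'a) \<Rightarrow> ('i \<times> 'a set) set" where
  "cuts z = {(\<alpha>, C). \<alpha> \<in> I \<and> (\<forall>b\<in>C. \<forall>a. (a, b) \<in> r \<alpha> \<longrightarrow> a \<in> C) \<and>
                     (fst z \<alpha> \<in> C) \<noteq> (snd z \<alpha> \<in> C)}"

text \<open>A pair of equal points has no cuts, so such pairs may be repeated and used to pad a
  family.\<close>

definition families :: "nat \<Rightarrow> (nat \<Rightarrow> ('i \<Rightarrow> 'a) \<times> ('i \<Rightarrow> 'a)) set" where
  "families n = {p. (\<forall>j<n. p j \<in> D0 \<times> D0) \<and>
                    (\<forall>j<n. \<forall>k<n. j \<noteq> k \<longrightarrow> cuts (p j) \<inter> cuts (p k) = {})}"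

definition osc :: "(('i \<Rightarrow> 'a) \<Rightarrow> real) \<Rightarrow> ('i \<Rightarrow> 'a) \<times> ('i \<Rightarrow> 'a) \<Rightarrow> real" where
  "osc f z = \<bar>f (fst z) - f (snd z)\<bar>"

definition total_osc ::
  "nat \<Rightarrow> (nat \<Rightarrow> ('i \<Rightarrow> 'a) \<times> ('i \<Rightarrow> 'a)) \<Rightarrow> (('i \<Rightarrow> 'a) \<Rightarrow> real) \<Rightarrow> real" where
  "total_osc n p f = \<bar>f e\<bar> + (\<Sum>j<n. osc f (p j))"

definition P :: "nat \<Rightarrow> (('i \<Rightarrow> 'a) \<Rightarrow> real) \<Rightarrow> real" where
  "P n f = (SUP p\<in>families n. total_osc n p f)"

section \<open>The dense set of finite modifications of the base point\<close>

lemma D_subset: "\<alpha> \<in> I \<Longrightarrow> D \<alpha> \<subseteq> L \<alpha>"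
  using dense by (auto simp: dense_subset_of_def)

lemma topspace_K: "topspace K = (\<Pi>\<^sub>E \<alpha>\<in>I. L \<alpha>)"
  by simp

lemma compact_K: "compact_space K"
  using compact by (simp add: compact_space_product_topology)

lemma D0_subset_PiE: "D0 \<subseteq> (\<Pi>\<^sub>E \<alpha>\<in>I. D \<alpha>)"
  by (auto simp: D0_def)

lemma PiE_D_subset: "(\<Pi>\<^sub>E \<alpha>\<in>I. D \<alpha>) \<subseteq> topspace K"
  unfolding topspace_K using D_subset by (intro PiE_mono)

lemma D0_subset: "D0 \<subseteq> topspace K"
  using D0_subset_PiE PiE_D_subset by (rule subset_trans)

lemma e_in_D0: "e \<in> D0"
  using e by (simp add: D0_def)

lemma D0_coord: "x \<in> D0 \<Longrightarrow> \<alpha> \<in> I \<Longrightarrow> x \<alpha> \<in> D \<alpha>"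
  using D0_subset_PiE by auto

lemma D0_update:
  assumes "x \<in> D0" "\<alpha> \<in> I" "a \<in> D \<alpha>"
  shows "x(\<alpha> := a) \<in> D0"
proof -
  have "x(\<alpha> := a) \<in> (\<Pi>\<^sub>E \<alpha>\<in>insert \<alpha> I. D \<alpha>)"
    using assms D0_subset_PiE by (intro PiE_fun_upd) auto
  moreover have "finite {\<beta> \<in> I. (x(\<alpha> := a)) \<beta> \<noteq> e \<beta>}"
    by (rule finite_subset[of _ "insert \<alpha> {\<beta> \<in> I. x \<beta> \<noteq> e \<beta>}"]) (use assms(1) in \<open>auto simp: D0_def\<close>)
  ultimately show ?thesis using assms(2) by (simp add: D0_def insert_absorb)
qed

text \<open>A basic open box constrains finitely many coordinates; choose those in
  \<open>D \<alpha>\<close> and copy \<open>e\<close> elsewhere.\<close>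

lemma D0_dense:
  assumes "openin K U" "x \<in> U"
  shows "\<exists>d\<in>D0. d \<in> U"
proof -
  obtain V where V: "finite {\<alpha> \<in> I. V \<alpha> \<noteq> topspace (order_top_of (L \<alpha>) (r \<alpha>))}"
      "\<forall>\<alpha>\<in>I. openin (order_top_of (L \<alpha>) (r \<alpha>)) (V \<alpha>)" "x \<in> Pi\<^sub>E I V" "Pi\<^sub>E I V \<subseteq> U"
    using assms unfolding openin_product_topology_alt by blast
  let ?F = "{\<alpha> \<in> I. V \<alpha> \<noteq> L \<alpha>}"
  have "\<forall>\<alpha>\<in>?F. \<exists>d. d \<in> D \<alpha> \<and> d \<in> V \<alpha>"
  proof
    fix \<alpha> assume "\<alpha> \<in> ?F"
    then have "x \<alpha> \<in> V \<alpha>" "\<alpha> \<in> I" using V(3) by auto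
    then show "\<exists>d. d \<in> D \<alpha> \<and> d \<in> V \<alpha>"
      using dense_subset_ofD[OF dense] V(2) by blast
  qed
  from bchoice[OF this] obtain d where d: "\<forall>\<alpha>\<in>?F. d \<alpha> \<in> D \<alpha> \<and> d \<alpha> \<in> V \<alpha>" by blast
  define y where "y \<alpha> = (if \<alpha> \<in> ?F then d \<alpha> else e \<alpha>)" for \<alpha>
  have "y \<in> (\<Pi>\<^sub>E \<alpha>\<in>I. D \<alpha>)"
  proof (rule PiE_I)
    show "y \<alpha> \<in> D \<alpha>" if "\<alpha> \<in> I" for \<alpha>
      using that d PiE_mem[OF e that] unfolding y_def by auto
    show "y \<alpha> = undefined" if "\<alpha> \<notin> I" for \<alpha>
      using that PiE_arb[OF e that] unfolding y_def by auto
  qed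
  moreover have "finite {\<alpha> \<in> I. y \<alpha> \<noteq> e \<alpha>}"
    by (rule finite_subset[OF _ V(1)]) (auto simp: y_def)
  ultimately have "y \<in> D0" by (simp add: D0_def)
  moreover have "y \<in> Pi\<^sub>E I V"
  proof (rule PiE_I)
    show "y \<alpha> \<in> V \<alpha>" if "\<alpha> \<in> I" for \<alpha>
      using that d D_subset[OF that] PiE_mem[OF e that] unfolding y_def by auto
    show "y \<alpha> = undefined" if "\<alpha> \<notin> I" for \<alpha>
      using that PiE_arb[OF e that] unfolding y_def by auto
  qed
  ultimately show ?thesis using V(4) by blast
qed

text \<open>The open set where the absolute value exceeds \<open>c\<close> would otherwise meet
  \<open>D0\<close>.\<close>

lemma sup_norm_le_D0:
  assumes f: "f \<in> cont_functions K" and "0 \<le> c" and le: "\<And>x. x \<in> D0 \<Longrightarrow> \<bar>f x\<bar> \<le> c"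
  shows "sup_norm K f \<le> c"
proof (rule sup_norm_leI[OF \<open>0 \<le> c\<close>], rule ccontr)
  fix x assume x: "x \<in> topspace K" "\<not> \<bar>f x\<bar> \<le> c"
  have "openin K {y \<in> topspace K. f y \<in> - {-c..c}}"
    by (intro openin_continuous_map_preimage[OF cont_functionsD(1)[OF f]]) (simp add: open_Compl)
  moreover have "x \<in> {y \<in> topspace K. f y \<in> - {-c..c}}" using x by auto
  ultimately obtain d where "d \<in> D0" "d \<in> {y \<in> topspace K. f y \<in> - {-c..c}}"
    using D0_dense by blast
  then show False using le[of d] by auto
qed

section \<open>Finitely many cuts control a continuous function\<close>

lemma cuts_self: "cuts (x, x) = {}"
  by (auto simp: cuts_def)

lemma cuts_swap: "cuts (y, x) = cuts (x, y)"
  by (auto simp: cuts_def)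

lemma osc_swap: "osc f (y, x) = osc f (x, y)"
  by (simp add: osc_def abs_minus_commute)

text \<open>A cell is a class of points not separated by any cut in \<open>T\<close>, and
  \<open>U\<close> is an open union of cells. Such sets form a base of the product topology.\<close>

definition cell_union :: "('i \<Rightarrow> 'a) set \<Rightarrow> ('i \<times> 'a set) set \<Rightarrow> bool" where
  "cell_union U T \<longleftrightarrow> openin K U \<and> finite T \<and>
     (\<forall>x\<in>U. \<forall>y\<in>topspace K. cuts (x, y) \<inter> T = {} \<longrightarrow> y \<in> U)"

lemma cell_union_Int:
  "cell_union U T \<Longrightarrow> cell_union U' T' \<Longrightarrow> cell_union (U \<inter> U') (T \<union> T')"
  unfolding cell_union_def by (auto simp: Int_Un_distrib)

text \<open>Induction on the generation of \<open>V\<close>: an open ray is described by a single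
  cut, an intersection unites the sets of cuts, and for a union one member around
  \<open>x \<alpha>\<close> is enough.\<close>

lemma cell_union_coord_nbhd:
  assumes "\<alpha> \<in> I" "openin (order_top_of (L \<alpha>) (r \<alpha>)) V" "x \<in> topspace K" "x \<alpha> \<in> V"
  shows "\<exists>U T. cell_union U T \<and> x \<in> U \<and> (\<forall>y\<in>U. y \<alpha> \<in> V)"
proof -
  note o = linear_order_onD[OF lin[OF \<open>\<alpha> \<in> I\<close>]]
  have "generate_topology_on ({L \<alpha>} \<union> {{x \<in> L \<alpha>. (x, a) \<in> r \<alpha> \<and> x \<noteq> a} | a. a \<in> L \<alpha>}
          \<union> {{x \<in> L \<alpha>. (a, x) \<in> r \<alpha> \<and> x \<noteq> a} | a. a \<in> L \<alpha>}) V"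
    using assms(2) unfolding order_top_of_def by (rule openin_topology_generated_by)
  then show ?thesis
    using assms(4)
  proof induction
    case Empty
    then show ?case by simp
  next
    case (Int V V')
    then have "x \<alpha> \<in> V" "x \<alpha> \<in> V'" by auto
    obtain U T where "cell_union U T" "x \<in> U" "\<forall>y\<in>U. y \<alpha> \<in> V"
      using Int.IH(1)[OF \<open>x \<alpha> \<in> V\<close>] by blast
    moreover obtain U' T' where "cell_union U' T'" "x \<in> U'" "\<forall>y\<in>U'. y \<alpha> \<in> V'"
      using Int.IH(2)[OF \<open>x \<alpha> \<in> V'\<close>] by blast
    ultimately show ?case
      using cell_union_Int by (intro exI[of _ "U \<inter> U'"] exI[of _ "T \<union> T'"]) auto
  next
    case (UN \<V>)
    then obtain V where V: "V \<in> \<V>" "x \<alpha> \<in> V" by blast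
    then show ?case using UN.IH[OF V] by blast
  next
    case (Basis V)
    let ?U = "{y \<in> topspace K. y \<alpha> \<in> V}"
    have "openin (order_top_of (L \<alpha>) (r \<alpha>)) V"
      unfolding order_top_of_def using Basis(1) by (rule topology_generated_by_Basis)
    then have op: "openin K ?U"
      using \<open>\<alpha> \<in> I\<close> by (intro openin_continuous_map_preimage[OF continuous_map_product_projection])
    have coord: "y \<alpha> \<in> L \<alpha>" if "y \<in> topspace K" for y
      using that \<open>\<alpha> \<in> I\<close> unfolding topspace_K by blast
    have "\<exists>T. cell_union ?U T"
      using Basis(1)
    proof (elim UnE)
      assume "V \<in> {L \<alpha>}"
      then have "cell_union ?U {}"
        using op coord by (auto simp: cell_union_def)
      then show ?thesis ..
    next
      assume "V \<in> {{x \<in> L \<alpha>. (x, a) \<in> r \<alpha> \<and> x \<noteq> a} | a. a \<in> L \<alpha>}"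
      then obtain a where V: "V = {x \<in> L \<alpha>. (x, a) \<in> r \<alpha> \<and> x \<noteq> a}" by blast
      \<comment> \<open>The ray below \<open>a\<close> is itself an initial segment and thus a
        cut.\<close>
      have "y \<alpha> \<in> V" if "z \<alpha> \<in> V" "cuts (z, y) \<inter> {(\<alpha>, V)} = {}" "y \<in> topspace K" for y z
      proof -
        have "\<forall>b\<in>V. \<forall>a. (a, b) \<in> r \<alpha> \<longrightarrow> a \<in> V"
        proof (intro ballI allI impI)
          fix b c assume "b \<in> V" "(c, b) \<in> r \<alpha>"
          then have "(b, a) \<in> r \<alpha>" "b \<noteq> a" "c \<in> L \<alpha>" using V o(1) by auto
          then have "(c, a) \<in> r \<alpha>" "c \<noteq> a" using o(3,4) \<open>(c, b) \<in> r \<alpha>\<close> by metis+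
          then show "c \<in> V" using V \<open>c \<in> L \<alpha>\<close> by blast
        qed
        then show ?thesis using that \<open>\<alpha> \<in> I\<close> by (auto simp: cuts_def)
      qed
      then have "cell_union ?U {(\<alpha>, V)}"
        using op by (auto simp: cell_union_def)
      then show ?thesis ..
    next
      assume "V \<in> {{x \<in> L \<alpha>. (a, x) \<in> r \<alpha> \<and> x \<noteq> a} | a. a \<in> L \<alpha>}"
      then obtain a where a: "a \<in> L \<alpha>" and V: "V = {x \<in> L \<alpha>. (a, x) \<in> r \<alpha> \<and> x \<noteq> a}" by blast
      \<comment> \<open>The ray above \<open>a\<close> is not an initial segment, but its complement
        in \<open>L \<alpha>\<close> is.\<close>
      let ?C = "{x. (x, a) \<in> r \<alpha>}"
      have C: "b \<notin> ?C \<longleftrightarrow> b \<in> V" if "b \<in> L \<alpha>" for b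
        using o(2)[OF that] o(4)[of a b] o(5)[OF a that] that unfolding V by auto
      have "y \<alpha> \<in> V" if "z \<alpha> \<in> V" "cuts (z, y) \<inter> {(\<alpha>, ?C)} = {}" "z \<in> topspace K" "y \<in> topspace K"
        for y z
      proof -
        have "\<forall>b\<in>?C. \<forall>a. (a, b) \<in> r \<alpha> \<longrightarrow> a \<in> ?C"
          using o(3) by blast
        then have "(z \<alpha> \<in> ?C) = (y \<alpha> \<in> ?C)"
          using that(2) \<open>\<alpha> \<in> I\<close> unfolding cuts_def by auto
        then show ?thesis using C coord that by blast
      qed
      then have "cell_union ?U {(\<alpha>, ?C)}"
        using op by (auto simp: cell_union_def)
      then show ?thesis ..
    qed
    then show ?case using Basis(2) assms(3) by blast
  qed
qed

text \<open>A basic box constrains finitely many coordinates; intersect the cell unions obtained for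
  each of them.\<close>

lemma cell_union_nbhd:
  assumes "openin K V" "x \<in> V"
  shows "\<exists>U T. cell_union U T \<and> x \<in> U \<and> U \<subseteq> V"
proof -
  have x: "x \<in> topspace K" using assms openin_subset by blast
  obtain W where W: "finite {\<alpha> \<in> I. W \<alpha> \<noteq> topspace (order_top_of (L \<alpha>) (r \<alpha>))}"
      "\<forall>\<alpha>\<in>I. openin (order_top_of (L \<alpha>) (r \<alpha>)) (W \<alpha>)" "x \<in> Pi\<^sub>E I W" "Pi\<^sub>E I W \<subseteq> V"
    using assms unfolding openin_product_topology_alt by blast
  have "\<exists>U T. cell_union U T \<and> x \<in> U \<and> (\<forall>y\<in>U. \<forall>\<alpha>\<in>F. y \<alpha> \<in> W \<alpha>)"
    if "finite F" "F \<subseteq> I" for F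
    using that
  proof (induction F rule: finite_induct)
    case empty
    have "cell_union (topspace K) {}" using openin_topspace by (simp only: cell_union_def) blast
    then show ?case using x by blast
  next
    case (insert \<alpha> F)
    then have "\<alpha> \<in> I" "F \<subseteq> I" by auto
    obtain U T where "cell_union U T" "x \<in> U" "\<forall>y\<in>U. \<forall>\<alpha>\<in>F. y \<alpha> \<in> W \<alpha>"
      using insert.IH[OF \<open>F \<subseteq> I\<close>] by blast
    moreover obtain U' T' where "cell_union U' T'" "x \<in> U'" "\<forall>y\<in>U'. y \<alpha> \<in> W \<alpha>"
      using cell_union_coord_nbhd[OF \<open>\<alpha> \<in> I\<close> _ x] W(2,3) \<open>\<alpha> \<in> I\<close> by (metis PiE_mem)
    ultimately show ?case
      using cell_union_Int by (intro exI[of _ "U \<inter> U'"] exI[of _ "T \<union> T'"]) auto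
  qed
  from this[OF W(1)] obtain U T where U: "cell_union U T" "x \<in> U"
      "\<forall>y\<in>U. \<forall>\<alpha>\<in>{\<alpha> \<in> I. W \<alpha> \<noteq> topspace (order_top_of (L \<alpha>) (r \<alpha>))}. y \<alpha> \<in> W \<alpha>"
    by blast
  have "U \<subseteq> Pi\<^sub>E I W"
  proof
    fix y assume "y \<in> U"
    then have y: "y \<in> (\<Pi>\<^sub>E \<alpha>\<in>I. L \<alpha>)"
      using U(1) openin_subset unfolding cell_union_def topspace_K[symmetric] by blast
    show "y \<in> Pi\<^sub>E I W"
    proof (rule PiE_I)
      show "y \<alpha> \<in> W \<alpha>" if "\<alpha> \<in> I" for \<alpha>
        using U(3) \<open>y \<in> U\<close> that PiE_mem[OF y that] by (cases "W \<alpha> = L \<alpha>") auto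
      show "y \<alpha> = undefined" if "\<alpha> \<notin> I" for \<alpha> using PiE_arb[OF y that] .
    qed
  qed
  then show ?thesis using U W(4) by blast
qed

text \<open>Around each point take a cell union on which \<open>f\<close> stays within \<epsilon>/2
  of its value at that point. Points not separated by its cuts stay in it together. Compactness
  leaves finitely many cell unions, whose cuts are collected.\<close>

lemma finitely_many_cuts:
  assumes f: "f \<in> cont_functions K" and "0 < \<epsilon>"
  shows "\<exists>T. finite T \<and>
    (\<forall>x\<in>topspace K. \<forall>y\<in>topspace K. cuts (x, y) \<inter> T = {} \<longrightarrow> \<bar>f x - f y\<bar> < \<epsilon>)"
proof -
  let ?Q = "\<lambda>U. \<exists>T. finite T \<and> (\<forall>x\<in>U. \<forall>y\<in>topspace K. cuts (x, y) \<inter> T = {} \<longrightarrow> \<bar>f x - f y\<bar> < \<epsilon>)"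
  have "\<exists>\<F>. finite \<F> \<and> (\<forall>U\<in>\<F>. ?Q U) \<and> topspace K \<subseteq> \<Union>\<F>"
  proof (rule compact_space_finite_cover[OF compact_K])
    fix x assume x: "x \<in> topspace K"
    have "openin K {y \<in> topspace K. f y \<in> ball (f x) (\<epsilon> / 2)}"
      by (intro openin_continuous_map_preimage[OF cont_functionsD(1)[OF f]]) simp
    then obtain U T where U: "cell_union U T" "x \<in> U"
        "U \<subseteq> {y \<in> topspace K. f y \<in> ball (f x) (\<epsilon> / 2)}"
      using cell_union_nbhd[of _ x] x \<open>0 < \<epsilon>\<close> by (metis (mono_tags, lifting) centre_in_ball half_gt_zero mem_Collect_eq)
    have "\<bar>f y - f z\<bar> < \<epsilon>" if "y \<in> U" "z \<in> topspace K" "cuts (y, z) \<inter> T = {}" for y z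
    proof -
      have "z \<in> U" using that U(1) unfolding cell_union_def by blast
      then have "\<bar>f x - f y\<bar> < \<epsilon> / 2" "\<bar>f x - f z\<bar> < \<epsilon> / 2"
        using U(3) \<open>y \<in> U\<close> by (auto simp: dist_real_def)
      then show ?thesis by linarith
    qed
    moreover have "finite T" "openin K U" using U(1) unfolding cell_union_def by auto
    ultimately show "\<exists>U. openin K U \<and> x \<in> U \<and> ?Q U" using U(2) by blast
  qed
  then obtain \<F> where \<F>: "finite \<F>" "\<forall>U\<in>\<F>. ?Q U" "topspace K \<subseteq> \<Union>\<F>" by blast
  from bchoice[OF \<F>(2)] obtain T where T: "\<forall>U\<in>\<F>. finite (T U) \<and>
      (\<forall>x\<in>U. \<forall>y\<in>topspace K. cuts (x, y) \<inter> T U = {} \<longrightarrow> \<bar>f x - f y\<bar> < \<epsilon>)" ..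
  show ?thesis
  proof (intro exI[of _ "\<Union>U\<in>\<F>. T U"] conjI ballI impI)
    fix x y assume xy: "x \<in> topspace K" "y \<in> topspace K" "cuts (x, y) \<inter> (\<Union>U\<in>\<F>. T U) = {}"
    then obtain U where "U \<in> \<F>" "x \<in> U" using \<F>(3) by blast
    moreover from this have "cuts (x, y) \<inter> T U = {}" using xy(3) by blast
    ultimately show "\<bar>f x - f y\<bar> < \<epsilon>" using T xy(2) by blast
  qed (use T \<F>(1) in auto)
qed

section \<open>The seminorms \<open>P n\<close> and their growth\<close>

lemma families_const: "(\<lambda>_. (x, x)) \<in> families n" if "x \<in> D0"
  using that by (simp add: families_def cuts_self)

lemma total_osc_le:
  assumes "f \<in> cont_functions K"
  shows "total_osc n p f \<le> (2 * n + 1) * sup_norm K f"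
proof -
  note le = abs_le_sup_norm[OF compact_K assms]
  have "osc f (p j) \<le> 2 * sup_norm K f" for j
    using le[of "fst (p j)"] le[of "snd (p j)"] unfolding osc_def by linarith
  then have "(\<Sum>j<n. osc f (p j)) \<le> (\<Sum>j<n. 2 * sup_norm K f)"
    by (intro sum_mono)
  then show ?thesis
    using le[of e] by (simp add: total_osc_def algebra_simps)
qed

lemma total_osc_le_P:
  assumes "f \<in> cont_functions K" "p \<in> families n"
  shows "total_osc n p f \<le> P n f"
  unfolding P_def
  by (rule cSUP_upper[OF assms(2) bdd_aboveI2]) (rule total_osc_le[OF assms(1)])

lemma P_leI: "(\<And>p. p \<in> families n \<Longrightarrow> total_osc n p f \<le> c) \<Longrightarrow> P n f \<le> c"
  unfolding P_def using families_const[OF e_in_D0] by (intro cSUP_least) auto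

lemma less_PD:
  assumes "c < P n f"
  shows "\<exists>p\<in>families n. c < total_osc n p f"
  using P_leI[of n f c] assms by (meson leD leI)

lemma P_nonneg:
  assumes "f \<in> cont_functions K"
  shows "0 \<le> P n f"
proof -
  have "0 \<le> total_osc n (\<lambda>_. (e, e)) f"
    by (auto simp: total_osc_def osc_def)
  then show ?thesis
    using total_osc_le_P[OF assms families_const[OF e_in_D0]] by (rule order_trans)
qed

lemma P_le: "f \<in> cont_functions K \<Longrightarrow> P n f \<le> (2 * n + 1) * sup_norm K f"
  by (rule P_leI) (rule total_osc_le)

lemma total_osc_scale: "total_osc n p (\<lambda>x. c * f x) = \<bar>c\<bar> * total_osc n p f"
  by (simp add: total_osc_def osc_def abs_mult sum_distrib_left distrib_left
      flip: right_diff_distrib)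

lemma P_scale:
  assumes "f \<in> cont_functions K"
  shows "P n (\<lambda>x. c * f x) = \<bar>c\<bar> * P n f"
proof -
  have le: "P n (\<lambda>x. c * f x) \<le> \<bar>c\<bar> * P n f" if "f \<in> cont_functions K" for c f
    by (rule P_leI, unfold total_osc_scale)
      (use total_osc_le_P[OF that] in \<open>auto intro: mult_left_mono\<close>)
  show ?thesis
  proof (cases "c = 0")
    case True
    then show ?thesis
      using le[OF assms, of 0] P_nonneg[OF cont_functions_zero, of n] by simp
  next
    case False
    \<comment> \<open>The reverse inequality is the first one for the multiple of \<open>f\<close>,
      with factor \<open>1 / c\<close>.\<close>
    then have "P n f \<le> \<bar>1 / c\<bar> * P n (\<lambda>x. c * f x)"
      using le[OF cont_functions_scale[OF assms, of c], of "1 / c"] by simp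
    then have "\<bar>c\<bar> * P n f \<le> P n (\<lambda>x. c * f x)"
      using False by (simp add: field_simps)
    then show ?thesis using le[OF assms] by (intro antisym)
  qed
qed

lemma P_add:
  assumes "f \<in> cont_functions K" "g \<in> cont_functions K"
  shows "P n (\<lambda>x. f x + g x) \<le> P n f + P n g"
proof (rule P_leI)
  fix p assume p: "p \<in> families n"
  have "osc (\<lambda>x. f x + g x) z \<le> osc f z + osc g z" for z
    unfolding osc_def by linarith
  then have "(\<Sum>j<n. osc (\<lambda>x. f x + g x) (p j)) \<le> (\<Sum>j<n. osc f (p j) + osc g (p j))"
    by (intro sum_mono)
  then have "total_osc n p (\<lambda>x. f x + g x) \<le> total_osc n p f + total_osc n p g"
    using abs_triangle_ineq[of "f e" "g e"] by (simp add: total_osc_def sum.distrib)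
  then show "total_osc n p (\<lambda>x. f x + g x) \<le> P n f + P n g"
    using total_osc_le_P[OF _ p] assms by (meson add_mono order_trans)
qed

lemma sup_norm_le_P1:
  assumes f: "f \<in> cont_functions K"
  shows "sup_norm K f \<le> P 1 f"
proof (rule sup_norm_le_D0[OF f P_nonneg[OF f]])
  fix x assume "x \<in> D0"
  then have "(\<lambda>_. (x, e)) \<in> families 1"
    using e_in_D0 by (simp add: families_def)
  moreover have "\<bar>f x\<bar> \<le> total_osc 1 (\<lambda>_. (x, e)) f"
    by (simp add: total_osc_def osc_def)
  ultimately show "\<bar>f x\<bar> \<le> P 1 f"
    using total_osc_le_P[OF f] by (meson order_trans)
qed

lemma tendsto_total_osc:
  assumes "p \<in> families n" "\<And>x. x \<in> D0 \<Longrightarrow> ((\<lambda>g. g x) \<longlongrightarrow> f x) F"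
  shows "((\<lambda>g. total_osc n p g) \<longlongrightarrow> total_osc n p f) F"
  unfolding total_osc_def osc_def
proof (intro tendsto_add tendsto_sum tendsto_rabs tendsto_diff assms(2) e_in_D0)
  fix j assume "j \<in> {..<n}"
  then have "p j \<in> D0 \<times> D0" using assms(1) by (auto simp: families_def)
  then show "fst (p j) \<in> D0" "snd (p j) \<in> D0" by auto
qed

text \<open>A supremum of functions of \<open>g\<close>, each depending continuously on finitely
  many values at points of \<open>D0\<close>.\<close>

lemma P_lsc:
  assumes "\<forall>\<^sub>F g in F. g \<in> cont_functions K" "\<And>x. x \<in> D0 \<Longrightarrow> ((\<lambda>g. g x) \<longlongrightarrow> f x) F"
    and "c < P n f"
  shows "\<forall>\<^sub>F g in F. c < P n g"
proof -
  obtain p where p: "p \<in> families n" "c < total_osc n p f"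
    using less_PD[OF assms(3)] by blast
  have "\<forall>\<^sub>F g in F. c < total_osc n p g"
    by (rule order_tendstoD(1)[OF tendsto_total_osc[OF p(1) assms(2)] p(2)])
  then show ?thesis
    using assms(1)
  proof eventually_elim
    case (elim g)
    then show ?case using total_osc_le_P[OF elim(2) p(1)] by linarith
  qed
qed

text \<open>A pair on which \<open>f\<close> varies much crosses one of finitely many cuts, and each cut is crossed
  by at most one pair of a family.\<close>

lemma P_sublinear:
  fixes \<epsilon> :: real
  assumes f: "f \<in> cont_functions K" and "0 < \<epsilon>"
  shows "\<exists>C. \<forall>n. P n f \<le> C + n * \<epsilon>"
proof -
  obtain T where T: "finite T" "\<And>x y. x \<in> topspace K \<Longrightarrow> y \<in> topspace K \<Longrightarrow> cuts (x, y) \<inter> T = {} \<Longrightarrow> \<bar>f x - f y\<bar> < \<epsilon>"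
    using finitely_many_cuts[OF assms] by blast
  define M where "M = 2 * sup_norm K f"
  have "0 \<le> M" using sup_norm_nonneg[OF compact_K f] by (simp add: M_def)
  have osc_M: "osc f z \<le> M" for z
    using abs_le_sup_norm[OF compact_K f, of "fst z"] abs_le_sup_norm[OF compact_K f, of "snd z"]
    unfolding osc_def M_def by linarith
  have "P n f \<le> \<bar>f e\<bar> + M * card T + n * \<epsilon>" for n
  proof (rule P_leI)
    fix p assume p: "p \<in> families n"
    define J where "J = {j \<in> {..<n}. cuts (p j) \<inter> T \<noteq> {}}"
    have "\<forall>j\<in>J. \<exists>t. t \<in> cuts (p j) \<inter> T" unfolding J_def by blast
    from bchoice[OF this] obtain t where t: "\<forall>j\<in>J. t j \<in> cuts (p j) \<inter> T" ..
    have "inj_on t J"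
    proof (rule inj_onI, rule ccontr)
      fix j k assume jk: "j \<in> J" "k \<in> J" "t j = t k" "j \<noteq> k"
      then have "j < n" "k < n" by (auto simp: J_def)
      then have "cuts (p j) \<inter> cuts (p k) = {}"
        using p \<open>j \<noteq> k\<close> unfolding families_def by blast
      moreover have "t j \<in> cuts (p j)" "t j \<in> cuts (p k)" using t jk by auto
      ultimately show False by blast
    qed
    then have "card J \<le> card T"
      using t T(1) by (intro card_inj_on_le) auto
    have "osc f (p j) \<le> \<epsilon> + (if j \<in> J then M else 0)" if "j \<in> {..<n}" for j
    proof (cases "j \<in> J")
      case True
      then show ?thesis using osc_M[of "p j"] \<open>0 < \<epsilon>\<close> by simp
    next
      case False
      then have "cuts (fst (p j), snd (p j)) \<inter> T = {}" using that by (simp add: J_def)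
      moreover have "fst (p j) \<in> topspace K" "snd (p j) \<in> topspace K"
        using p that D0_subset by (auto simp: families_def mem_Times_iff)
      ultimately have "osc f (p j) < \<epsilon>" using T(2) unfolding osc_def by blast
      then show ?thesis using False by simp
    qed
    then have "(\<Sum>j<n. osc f (p j)) \<le> (\<Sum>j<n. \<epsilon> + (if j \<in> J then M else 0))"
      by (rule sum_mono)
    also have "\<dots> = n * \<epsilon> + M * card J"
    proof -
      have "{..<n} \<inter> J = J" by (auto simp: J_def)
      then show ?thesis by (simp add: sum.distrib sum.If_cases)
    qed
    also have "\<dots> \<le> n * \<epsilon> + M * card T"
      using \<open>card J \<le> card T\<close> \<open>0 \<le> M\<close> by (intro add_left_mono mult_left_mono) auto
    finally show "total_osc n p f \<le> \<bar>f e\<bar> + M * card T + n * \<epsilon>"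
      by (simp add: total_osc_def)
  qed
  then show ?thesis by blast
qed

text \<open>Otherwise \<open>P (2 * m) f\<close> would be at least m * \<epsilon>, while sublinear
  growth at rate \<epsilon>/4 allows only C + m * \<epsilon>/2.\<close>

lemma P_small_increment:
  assumes f: "f \<in> cont_functions K" and "0 < \<epsilon>"
  shows "\<exists>n. P (n + 2) f < P n f + \<epsilon>"
proof (rule ccontr)
  assume "\<not> ?thesis"
  then have step: "P n f + \<epsilon> \<le> P (n + 2) f" for n by (meson leI)
  have grow: "m * \<epsilon> \<le> P (2 * m) f" for m :: nat
  proof (induction m)
    case 0
    then show ?case using P_nonneg[OF f] by simp
  next
    case (Suc m)
    then show ?case using step[of "2 * m"] by (simp add: algebra_simps)
  qed
  obtain C where C: "\<And>n. P n f \<le> C + n * (\<epsilon> / 4)"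
    using P_sublinear[OF f, of "\<epsilon> / 4"] \<open>0 < \<epsilon>\<close> by auto
  obtain m :: nat where "C / (\<epsilon> / 2) < m" using reals_Archimedean2 by blast
  then have "C < m * \<epsilon> / 2" using \<open>0 < \<epsilon>\<close> by (simp add: field_simps)
  moreover have "m * \<epsilon> \<le> C + m * \<epsilon> / 2"
    using order_trans[OF grow[of m] C[of "2 * m"]] by (simp add: mult.commute)
  ultimately show False by simp
qed

section \<open>Nearly optimal families\<close>

lemma nearly_optimal_family:
  assumes f: "f \<in> cont_functions K" and F: "\<And>x. x \<in> D0 \<Longrightarrow> ((\<lambda>g. g x) \<longlongrightarrow> f x) F"
    and PF: "\<And>n \<eta>. 0 < \<eta> \<Longrightarrow> \<forall>\<^sub>F g in F. P n g < P n f + \<eta>" and "0 < \<epsilon>"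
  shows "\<exists>n. \<exists>p\<in>families n. \<forall>\<^sub>F g in F. P (n + 2) g < total_osc n p g + \<epsilon>"
proof -
  \<comment> \<open>Four errors of \<epsilon>/4: the increment of \<open>P\<close> at
    \<open>f\<close>, the choice of \<open>p\<close>, the passage from \<open>f\<close> to
    \<open>g\<close> in the total oscillation of \<open>p\<close>, and the excess of
    \<open>P (n + 2) g\<close> over \<open>P (n + 2) f\<close>.\<close>
  have "0 < \<epsilon> / 4" using \<open>0 < \<epsilon>\<close> by simp
  obtain n where n: "P (n + 2) f < P n f + \<epsilon> / 4"
    using P_small_increment[OF f \<open>0 < \<epsilon> / 4\<close>] by blast
  obtain p where p: "p \<in> families n" "P n f - \<epsilon> / 4 < total_osc n p f"
    using less_PD[of "P n f - \<epsilon> / 4" n f] \<open>0 < \<epsilon>\<close> by auto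
  have "\<forall>\<^sub>F g in F. total_osc n p f - \<epsilon> / 4 < total_osc n p g"
    by (rule order_tendstoD(1)[OF tendsto_total_osc[OF p(1) F]]) (use \<open>0 < \<epsilon>\<close> in auto)
  then have "\<forall>\<^sub>F g in F. P (n + 2) g < total_osc n p g + \<epsilon>"
    using PF[OF \<open>0 < \<epsilon> / 4\<close>, of "n + 2"]
  proof eventually_elim
    case (elim g)
    then show ?case using n p(2) by linarith
  qed
  then show ?thesis using p(1) by blast
qed

text \<open>Append \<open>z\<close> to the family and pad with \<open>(e, e)\<close>: near
  optimality leaves less than \<epsilon> for \<open>z\<close>.\<close>

lemma osc_less_of_disjoint:
  assumes g: "g \<in> cont_functions K" and p: "p \<in> families n"
    and opt: "P (n + 2) g < total_osc n p g + \<epsilon>"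
    and z: "z \<in> D0 \<times> D0" "\<And>j. j < n \<Longrightarrow> cuts z \<inter> cuts (p j) = {}"
  shows "osc g z < \<epsilon>"
proof -
  define q where "q = p(n := z, Suc n := (e, e))"
  have q: "q j = p j" if "j < n" for j using that by (simp add: q_def)
  have q': "q n = z" "q (Suc n) = (e, e)" by (simp_all add: q_def)
  have "q \<in> families (n + 2)"
    unfolding families_def
  proof (intro CollectI conjI allI impI)
    have p': "p j \<in> D0 \<times> D0" if "j < n" for j using p that by (auto simp: families_def)
    show "q j \<in> D0 \<times> D0" if "j < n + 2" for j
      using that q q' z(1) p' e_in_D0 by (auto simp: less_Suc_eq)
    have pp: "cuts (p j) \<inter> cuts (p k) = {}" if "j < n" "k < n" "j \<noteq> k" for j k
      using p that by (auto simp: families_def)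
    have lt: "j < n \<or> j = n \<or> j = Suc n" if "j < n + 2" for j
      using that by auto
    show "cuts (q j) \<inter> cuts (q k) = {}" if jk: "j < n + 2" "k < n + 2" "j \<noteq> k" for j k
      using lt[OF jk(1)] lt[OF jk(2)] jk(3) z(2) pp
      by (elim disjE) (simp_all add: q q' cuts_self Int_commute)
  qed
  then have "total_osc (n + 2) q g \<le> P (n + 2) g" by (rule total_osc_le_P[OF g])
  moreover have "total_osc (n + 2) q g = total_osc n p g + osc g z"
    by (simp add: total_osc_def q q') (simp add: osc_def)
  ultimately show ?thesis using opt by linarith
qed

text \<open>The first new pair takes the place of \<open>p i\<close> and the other two are appended;
  this is where families of n + 2 pairs come from.\<close>

lemma osc_split_less:
  assumes g: "g \<in> cont_functions K" and p: "p \<in> families n"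
    and opt: "P (n + 2) g < total_osc n p g + \<epsilon>" and "i < n"
    and z: "z1 \<in> D0 \<times> D0" "z2 \<in> D0 \<times> D0" "z3 \<in> D0 \<times> D0"
    and sub: "cuts z1 \<subseteq> cuts (p i)" "cuts z2 \<subseteq> cuts (p i)" "cuts z3 \<subseteq> cuts (p i)"
    and disj: "cuts z1 \<inter> cuts z2 = {}" "cuts z1 \<inter> cuts z3 = {}" "cuts z2 \<inter> cuts z3 = {}"
  shows "osc g z1 + osc g z2 + osc g z3 < osc g (p i) + \<epsilon>"
proof -
  define q where "q = p(i := z1, n := z2, Suc n := z3)"
  have q: "q j = p j" if "j < n" "j \<noteq> i" for j using that by (simp add: q_def)
  have q': "q i = z1" "q n = z2" "q (Suc n) = z3" using \<open>i < n\<close> by (simp_all add: q_def)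
  have "q \<in> families (n + 2)"
    unfolding families_def
  proof (intro CollectI conjI allI impI)
    have p': "p j \<in> D0 \<times> D0" if "j < n" for j using p that by (auto simp: families_def)
    show "q j \<in> D0 \<times> D0" if "j < n + 2" for j
      using that q' z p' by (cases "j = i") (auto simp: less_Suc_eq q)
    have pp: "cuts (p j) \<inter> cuts (p k) = {}" if "j < n" "k < n" "j \<noteq> k" for j k
      using p that by (auto simp: families_def)
    have new: "cuts z \<inter> cuts (p j) = {}" if "j < n" "j \<noteq> i" "z \<in> {z1, z2, z3}" for j z
      using pp[OF \<open>i < n\<close> that(1)] that sub by blast
    have lt: "j < n \<and> j \<noteq> i \<or> j = i \<or> j = n \<or> j = Suc n" if "j < n + 2" for j
      using that by auto
    show "cuts (q j) \<inter> cuts (q k) = {}" if jk: "j < n + 2" "k < n + 2" "j \<noteq> k" for j k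
      using lt[OF jk(1)] lt[OF jk(2)] jk(3) \<open>i < n\<close> new pp disj
      by (elim disjE) (auto simp: q q' Int_commute)
  qed
  then have "total_osc (n + 2) q g \<le> P (n + 2) g" by (rule total_osc_le_P[OF g])
  moreover have "total_osc (n + 2) q g + osc g (p i) = total_osc n p g + osc g z1 + osc g z2 + osc g z3"
  proof -
    have "(\<Sum>j<n. osc g (q j)) = osc g z1 + (\<Sum>j\<in>{..<n} - {i}. osc g (q j))"
      using \<open>i < n\<close> by (subst sum.remove[of _ i]) (auto simp: q')
    also have "(\<Sum>j\<in>{..<n} - {i}. osc g (q j)) = (\<Sum>j\<in>{..<n} - {i}. osc g (p j))"
      by (rule sum.cong) (auto simp: q)
    finally have "(\<Sum>j<n. osc g (q j)) + osc g (p i) = osc g z1 + (\<Sum>j<n. osc g (p j))"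
      using \<open>i < n\<close> by (subst (2) sum.remove[of _ i]) auto
    then show ?thesis by (simp add: total_osc_def q')
  qed
  ultimately show ?thesis using opt by linarith
qed

text \<open>Take for \<open>G\<close> the coordinates in which some pair of a nearly optimal family
  differs. If \<open>u\<close> and \<open>v\<close> agree on \<open>G\<close>, the pair
  \<open>(u, v)\<close> shares no cut with the family and adds little oscillation. The family is
  chosen from \<open>f\<close>, so one \<open>G\<close> serves eventually all
  \<open>g\<close>.\<close>

lemma finite_determining_coordinates:
  assumes f: "f \<in> cont_functions K" and V: "\<forall>\<^sub>F g in F. g \<in> cont_functions K"
    and F: "\<And>x. x \<in> D0 \<Longrightarrow> ((\<lambda>g. g x) \<longlongrightarrow> f x) F"
    and PF: "\<And>n \<eta>. 0 < \<eta> \<Longrightarrow> \<forall>\<^sub>F g in F. P n g < P n f + \<eta>" and "0 < \<epsilon>"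
  shows "\<exists>G. finite G \<and> G \<subseteq> I \<and>
    (\<forall>\<^sub>F g in F. \<forall>u\<in>D0. \<forall>v\<in>D0. (\<forall>\<alpha>\<in>G. u \<alpha> = v \<alpha>) \<longrightarrow> \<bar>g u - g v\<bar> < \<epsilon>)"
proof -
  obtain n p where p: "p \<in> families n" and opt: "\<forall>\<^sub>F g in F. P (n + 2) g < total_osc n p g + \<epsilon>"
    using nearly_optimal_family[OF f F PF \<open>0 < \<epsilon>\<close>] by blast
  define G where "G = (\<Union>j<n. {\<alpha> \<in> I. fst (p j) \<alpha> \<noteq> snd (p j) \<alpha>})"
  have "finite {\<alpha> \<in> I. x \<alpha> \<noteq> y \<alpha>}" if "x \<in> D0" "y \<in> D0" for x y
    by (rule finite_subset[of _ "{\<alpha> \<in> I. x \<alpha> \<noteq> e \<alpha>} \<union> {\<alpha> \<in> I. y \<alpha> \<noteq> e \<alpha>}"])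
      (use that in \<open>auto simp: D0_def\<close>)
  then have "finite G" "G \<subseteq> I"
    using p by (auto simp: G_def families_def mem_Times_iff)
  moreover have "\<forall>\<^sub>F g in F. \<forall>u\<in>D0. \<forall>v\<in>D0. (\<forall>\<alpha>\<in>G. u \<alpha> = v \<alpha>) \<longrightarrow> \<bar>g u - g v\<bar> < \<epsilon>"
    using opt V
  proof eventually_elim
    case (elim g)
    show ?case
    proof (intro ballI impI)
      fix u v assume uv: "u \<in> D0" "v \<in> D0" "\<forall>\<alpha>\<in>G. u \<alpha> = v \<alpha>"
      have "cuts (u, v) \<inter> cuts (p j) = {}" if "j < n" for j
      proof (rule equals0I)
        fix z assume z: "z \<in> cuts (u, v) \<inter> cuts (p j)"
        obtain \<beta> C where "z = (\<beta>, C)" by (cases z)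
        with z have "\<beta> \<in> I" "fst (p j) \<beta> \<noteq> snd (p j) \<beta>" "u \<beta> \<noteq> v \<beta>"
          by (auto simp: cuts_def)
        then show False using uv(3) that unfolding G_def by blast
      qed
      then have "osc g (u, v) < \<epsilon>"
        using uv by (intro osc_less_of_disjoint[OF elim(2) p elim(1)]) auto
      then show "\<bar>g u - g v\<bar> < \<epsilon>" by (simp add: osc_def)
    qed
  qed
  ultimately show ?thesis by blast
qed

section \<open>Variation along one coordinate\<close>

lemma continuous_map_line:
  assumes "f \<in> cont_functions K" "x \<in> topspace K" "\<alpha> \<in> I"
  shows "continuous_map (order_top_of (L \<alpha>) (r \<alpha>)) euclideanreal (\<lambda>a. f (x(\<alpha> := a)))"
proof -
  have "continuous_map (order_top_of (L \<alpha>) (r \<alpha>)) K (\<lambda>a. x(\<alpha> := a))"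
    unfolding continuous_map_componentwise
  proof (intro conjI ballI)
    show "(\<lambda>a. x(\<alpha> := a)) ` topspace (order_top_of (L \<alpha>) (r \<alpha>)) \<subseteq> extensional I"
      using assms(2,3) by (auto simp: extensional_def PiE_def)
    fix \<beta> assume "\<beta> \<in> I"
    then have "x \<beta> \<in> L \<beta>" using assms(2) by auto
    then show "continuous_map (order_top_of (L \<alpha>) (r \<alpha>)) (order_top_of (L \<beta>) (r \<beta>))
        (\<lambda>a. (x(\<alpha> := a)) \<beta>)"
      by (cases "\<beta> = \<alpha>") auto
  qed
  then show ?thesis
    using continuous_map_compose[OF _ cont_functionsD(1)[OF assms(1)]] by (simp add: o_def)
qed

text \<open>For finite \<open>W\<close> only finitely many positions occur. As the inequalities are
  not strict, a point of \<open>W\<close> in \<open>L \<alpha>\<close> shares its position with no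
  other point.\<close>

definition position :: "'i \<Rightarrow> 'a set \<Rightarrow> 'a \<Rightarrow> 'a set \<times> 'a set" where
  "position \<alpha> W a = ({w \<in> W. (w, a) \<in> r \<alpha>}, {w \<in> W. (a, w) \<in> r \<alpha>})"

text \<open>
  If the pair \<open>(u, v)\<close> lies within the pair \<open>(x, y)\<close> of a nearly optimal family, enclose it between
  \<open>s\<close> and \<open>t\<close> and replace \<open>(x, y)\<close> by \<open>(x, s)\<close>, \<open>(u, v)\<close>, \<open>(t, y)\<close>: as this cannot increase the
  total oscillation much, \<open>\<bar>g u - g v\<bar>\<close> is at most about \<open>\<bar>g s - g t\<bar>\<close>.
\<close>

lemma finite_positions:
  assumes f: "f \<in> cont_functions K" and V: "\<forall>\<^sub>F g in F. g \<in> cont_functions K"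
    and F: "\<And>x. x \<in> D0 \<Longrightarrow> ((\<lambda>g. g x) \<longlongrightarrow> f x) F"
    and PF: "\<And>n \<eta>. 0 < \<eta> \<Longrightarrow> \<forall>\<^sub>F g in F. P n g < P n f + \<eta>" and "0 < \<delta>" and \<alpha>: "\<alpha> \<in> I"
  shows "\<exists>W. finite W \<and> (\<forall>\<^sub>F g in F. \<forall>u\<in>D0. \<forall>b\<in>D \<alpha>.
    position \<alpha> W (u \<alpha>) = position \<alpha> W b \<longrightarrow> \<bar>g u - g (u(\<alpha> := b))\<bar> < \<delta>)"
proof -
  note o = linear_order_onD[OF lin[OF \<alpha>]]
  have "0 < \<delta> / 3" "0 < \<delta> / 6" using \<open>0 < \<delta>\<close> by auto
  obtain n p where p: "p \<in> families n"
    and opt: "\<forall>\<^sub>F g in F. P (n + 2) g < total_osc n p g + \<delta> / 3"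
    using nearly_optimal_family[OF f F PF \<open>0 < \<delta> / 3\<close>] by blast
  \<comment> \<open>Each pair is oriented by its coordinate \<alpha>; neither its cuts nor its
    oscillation changes.\<close>
  define lo hi where "lo j = (if (fst (p j) \<alpha>, snd (p j) \<alpha>) \<in> r \<alpha> then fst (p j) else snd (p j))"
    and "hi j = (if (fst (p j) \<alpha>, snd (p j) \<alpha>) \<in> r \<alpha> then snd (p j) else fst (p j))" for j
  have "p j = (lo j, hi j) \<or> p j = (hi j, lo j)" for j
    by (auto simp: lo_def hi_def prod_eq_iff)
  then have p_eq: "cuts (p j) = cuts (lo j, hi j)" "osc g (p j) = osc g (lo j, hi j)" for j g
    by (metis cuts_swap, metis osc_swap)
  have D0: "lo j \<in> D0" "hi j \<in> D0" if "j < n" for j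
    using p that by (auto simp: lo_def hi_def families_def mem_Times_iff)
  have DL: "lo j \<alpha> \<in> D \<alpha>" "hi j \<alpha> \<in> D \<alpha>" if "j < n" for j
    using D0[OF that] D0_coord \<alpha> by auto
  have lohi: "(lo j \<alpha>, hi j \<alpha>) \<in> r \<alpha>" if "j < n" for j
  proof -
    have "fst (p j) \<in> D0" "snd (p j) \<in> D0"
      using p that by (auto simp: families_def mem_Times_iff)
    then have "fst (p j) \<alpha> \<in> L \<alpha>" "snd (p j) \<alpha> \<in> L \<alpha>"
      using D0_coord[OF _ \<alpha>] D_subset[OF \<alpha>] by blast+
    then show ?thesis using o(5) by (auto simp: lo_def hi_def)
  qed
  \<comment> \<open>The enclosing points come from \<open>f\<close> restricted to the line through
    \<open>lo j\<close> in direction \<alpha>.\<close>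
  have "\<forall>j\<in>{..<n}. \<exists>W. finite W \<and> W \<subseteq> D \<alpha> \<and>
      (\<forall>a\<in>D \<alpha>. (lo j \<alpha>, a) \<in> r \<alpha> \<longrightarrow> (a, hi j \<alpha>) \<in> r \<alpha> \<longrightarrow> a \<in> W \<or>
        (\<exists>c\<in>W. \<exists>d\<in>W. (lo j \<alpha>, c) \<in> r \<alpha> \<and> (c, a) \<in> r \<alpha> \<and> (a, d) \<in> r \<alpha> \<and> (d, hi j \<alpha>) \<in> r \<alpha> \<and>
          \<bar>f ((lo j)(\<alpha> := c)) - f ((lo j)(\<alpha> := d))\<bar> < \<delta> / 3))"
  proof
    fix j assume "j \<in> {..<n}"
    then have j: "j < n" by simp
    have "lo j \<in> topspace K" using D0(1)[OF j] D0_subset by blast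
    from finite_enclosing_set[OF lin[OF \<alpha>] compact[OF \<alpha>] dense[OF \<alpha>] adj[OF \<alpha>]
        continuous_map_line[OF f this \<alpha>] DL[OF j] \<open>0 < \<delta> / 3\<close>]
    show "\<exists>W. finite W \<and> W \<subseteq> D \<alpha> \<and>
      (\<forall>a\<in>D \<alpha>. (lo j \<alpha>, a) \<in> r \<alpha> \<longrightarrow> (a, hi j \<alpha>) \<in> r \<alpha> \<longrightarrow> a \<in> W \<or>
        (\<exists>c\<in>W. \<exists>d\<in>W. (lo j \<alpha>, c) \<in> r \<alpha> \<and> (c, a) \<in> r \<alpha> \<and> (a, d) \<in> r \<alpha> \<and> (d, hi j \<alpha>) \<in> r \<alpha> \<and>
          \<bar>f ((lo j)(\<alpha> := c)) - f ((lo j)(\<alpha> := d))\<bar> < \<delta> / 3))" .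
  qed
  from bchoice[OF this] obtain W where W: "\<And>j. j < n \<Longrightarrow> finite (W j)" "\<And>j. j < n \<Longrightarrow> W j \<subseteq> D \<alpha>"
    "\<And>j a. \<lbrakk>j < n; a \<in> D \<alpha>; (lo j \<alpha>, a) \<in> r \<alpha>; (a, hi j \<alpha>) \<in> r \<alpha>; a \<notin> W j\<rbrakk> \<Longrightarrow>
        \<exists>c\<in>W j. \<exists>d\<in>W j. (lo j \<alpha>, c) \<in> r \<alpha> \<and> (c, a) \<in> r \<alpha> \<and> (a, d) \<in> r \<alpha> \<and> (d, hi j \<alpha>) \<in> r \<alpha> \<and>
          \<bar>f ((lo j)(\<alpha> := c)) - f ((lo j)(\<alpha> := d))\<bar> < \<delta> / 3"
    by (metis lessThan_iff)
  \<comment> \<open>The endpoints are included so that the position tells whether a coordinate lies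
    between them.\<close>
  define Wt where "Wt = (\<Union>j<n. W j \<union> {lo j \<alpha>, hi j \<alpha>})"
  have Wt: "W j \<subseteq> Wt" "lo j \<alpha> \<in> Wt" "hi j \<alpha> \<in> Wt" if "j < n" for j
    using that by (auto simp: Wt_def)
  have "finite Wt" using W(1) by (auto simp: Wt_def)
  \<comment> \<open>Only finitely many points are involved, so pointwise convergence controls them
    all at once.\<close>
  have near: "\<forall>\<^sub>F g in F. \<forall>j\<in>{..<n}. \<forall>c\<in>W j.
      \<bar>g ((lo j)(\<alpha> := c)) - f ((lo j)(\<alpha> := c))\<bar> < \<delta> / 6"
  proof (intro eventually_ball_finite ballI)
    fix j c assume "j \<in> {..<n}" "c \<in> W j"
    then have "(lo j)(\<alpha> := c) \<in> D0" using D0(1) W(2) \<alpha> by (auto intro!: D0_update)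
    from tendstoD[OF F[OF this] \<open>0 < \<delta> / 6\<close>]
    show "\<forall>\<^sub>F g in F. \<bar>g ((lo j)(\<alpha> := c)) - f ((lo j)(\<alpha> := c))\<bar> < \<delta> / 6"
      by (simp add: dist_real_def)
  qed (use W(1) in auto)
  have "\<forall>\<^sub>F g in F. \<forall>u\<in>D0. \<forall>b\<in>D \<alpha>.
      position \<alpha> Wt (u \<alpha>) = position \<alpha> Wt b \<longrightarrow> \<bar>g u - g (u(\<alpha> := b))\<bar> < \<delta>"
    using opt V near
  proof eventually_elim
    case (elim g)
    show ?case
    proof (intro ballI impI)
      fix u b assume u: "u \<in> D0" and b: "b \<in> D \<alpha>" and "position \<alpha> Wt (u \<alpha>) = position \<alpha> Wt b"
      then have pos: "(w, u \<alpha>) \<in> r \<alpha> \<longleftrightarrow> (w, b) \<in> r \<alpha>" "(u \<alpha>, w) \<in> r \<alpha> \<longleftrightarrow> (b, w) \<in> r \<alpha>"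
        if "w \<in> Wt" for w using that unfolding position_def by blast+
      define v where "v = u(\<alpha> := b)"
      have v: "v \<in> D0" "v \<alpha> = b" unfolding v_def using D0_update[OF u \<alpha> b] by auto
      have a: "u \<alpha> \<in> D \<alpha>" using D0_coord[OF u \<alpha>] .
      have aL: "u \<alpha> \<in> L \<alpha>" using a D_subset[OF \<alpha>] by blast
      have "\<bar>g u - g v\<bar> < \<delta>"
      proof (cases "\<exists>j<n. cuts (u, v) \<inter> cuts (p j) \<noteq> {}")
        case False
        then have "osc g (u, v) < \<delta> / 3"
          using u v by (intro osc_less_of_disjoint[OF elim(2) p elim(1)]) auto
        then show ?thesis using \<open>0 < \<delta>\<close> by (simp add: osc_def)
      next
        case True
        then obtain j \<beta> C where j: "j < n" and "(\<beta>, C) \<in> cuts (u, v)"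
            "(\<beta>, C) \<in> cuts (lo j, hi j)"
          unfolding p_eq by auto
        then have C: "\<beta> = \<alpha>" "(u \<alpha> \<in> C) \<noteq> (b \<in> C)" "(lo j \<alpha> \<in> C) \<noteq> (hi j \<alpha> \<in> C)"
            "\<And>c d. d \<in> C \<Longrightarrow> (c, d) \<in> r \<alpha> \<Longrightarrow> c \<in> C"
          unfolding cuts_def v_def by (auto split: if_splits)
        have loC: "lo j \<alpha> \<in> C" "hi j \<alpha> \<notin> C" using C(3,4) lohi[OF j] by blast+
        have DL': "lo j \<alpha> \<in> L \<alpha>" "hi j \<alpha> \<in> L \<alpha>" using DL[OF j] D_subset[OF \<alpha>] by auto
        \<comment> \<open>A coordinate outside the interval would have \<open>b\<close> on its side
          of the endpoint too, so \<open>C\<close> could not separate both \<open>u \<alpha>\<close>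
          from \<open>b\<close> and \<open>lo j \<alpha>\<close> from
          \<open>hi j \<alpha>\<close>.\<close>
        have ge: "(lo j \<alpha>, u \<alpha>) \<in> r \<alpha>"
        proof (rule ccontr)
          assume "\<not> ?thesis"
          then have "(u \<alpha>, lo j \<alpha>) \<in> r \<alpha>" using o(5) aL DL' by blast
          then have "u \<alpha> \<in> C" "b \<in> C" using pos(2)[OF Wt(2)[OF j]] C(4) loC by blast+
          then show False using C(2) by blast
        qed
        have le: "(u \<alpha>, hi j \<alpha>) \<in> r \<alpha>"
        proof (rule ccontr)
          assume "\<not> ?thesis"
          then have "(hi j \<alpha>, u \<alpha>) \<in> r \<alpha>" using o(5) aL DL' by blast
          then have "u \<alpha> \<notin> C" "b \<notin> C" using pos(1)[OF Wt(3)[OF j]] C(4) loC by blast+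
          then show False using C(2) by blast
        qed
        have "u \<alpha> \<notin> W j"
        proof
          assume "u \<alpha> \<in> W j"
          then have "(u \<alpha>, b) \<in> r \<alpha>" "(b, u \<alpha>) \<in> r \<alpha>"
            using pos[of "u \<alpha>"] Wt(1)[OF j] o(2)[OF aL] by blast+
          then show False using o(4) C(2) by blast
        qed
        then obtain c d where cd: "c \<in> W j" "d \<in> W j" "(lo j \<alpha>, c) \<in> r \<alpha>" "(c, u \<alpha>) \<in> r \<alpha>"
            "(u \<alpha>, d) \<in> r \<alpha>" "(d, hi j \<alpha>) \<in> r \<alpha>"
            "\<bar>f ((lo j)(\<alpha> := c)) - f ((lo j)(\<alpha> := d))\<bar> < \<delta> / 3"
          using W(3)[OF j a ge le] by blast
        have cdb: "(c, b) \<in> r \<alpha>" "(b, d) \<in> r \<alpha>"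
          using cd pos Wt(1)[OF j] by blast+
        let ?s = "(lo j)(\<alpha> := c)" and ?t = "(lo j)(\<alpha> := d)"
        have st: "?s \<in> D0" "?t \<in> D0"
          using cd W(2)[OF j] D0(1)[OF j] \<alpha> by (auto intro!: D0_update)
        \<comment> \<open>Membership in an initial segment passes down the order, and
          \<open>u \<alpha>\<close> and \<open>b\<close> both lie between \<open>c\<close> and
          \<open>d\<close>. Hence a cut in direction \<alpha> falls into at most one of the three
          pieces.\<close>
        define down where "down C' \<longleftrightarrow> (\<forall>b\<in>C'. \<forall>a. (a, b) \<in> r \<alpha> \<longrightarrow> a \<in> C')" for C'
        have chain: "(lo j \<alpha> \<in> C' \<or> c \<notin> C') \<and> (c \<in> C' \<or> u \<alpha> \<notin> C') \<and> (u \<alpha> \<in> C' \<or> d \<notin> C') \<and>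
            (c \<in> C' \<or> b \<notin> C') \<and> (b \<in> C' \<or> d \<notin> C') \<and> (d \<in> C' \<or> hi j \<alpha> \<notin> C')"
          if "down C'" for C'
          using that cd(3-6) cdb unfolding down_def by blast
        have cuts_\<alpha>: "(\<alpha>, C') \<in> cuts (x, y) \<longleftrightarrow> down C' \<and> (x \<alpha> \<in> C') \<noteq> (y \<alpha> \<in> C')" for x y C'
          using \<alpha> by (simp add: cuts_def down_def)
        have s: "(\<beta>, C') \<in> cuts (lo j, hi j) \<and> (\<beta>, C') \<notin> cuts (u, v) \<and> (\<beta>, C') \<notin> cuts (?t, hi j)"
          if *: "(\<beta>, C') \<in> cuts (lo j, ?s)" for \<beta> C'
        proof -
          have "\<beta> = \<alpha>" using * by (rule contrapos_pp) (simp add: cuts_def)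
          then show ?thesis using * chain[of C'] v(2) by (auto simp: cuts_\<alpha>)
        qed
        have uv: "(\<beta>, C') \<in> cuts (lo j, hi j) \<and> (\<beta>, C') \<notin> cuts (?t, hi j)"
          if *: "(\<beta>, C') \<in> cuts (u, v)" for \<beta> C'
        proof -
          have "\<beta> = \<alpha>" using * by (rule contrapos_pp) (simp add: cuts_def v_def)
          then show ?thesis using * chain[of C'] v(2) by (auto simp: cuts_\<alpha>)
        qed
        \<comment> \<open>The third pair alone can have cuts in other coordinates; there
          \<open>?t\<close> agrees with \<open>lo j\<close>, so they are cuts of the old
          pair.\<close>
        have t: "(\<beta>, C') \<in> cuts (lo j, hi j)" if *: "(\<beta>, C') \<in> cuts (?t, hi j)" for \<beta> C'
        proof (cases "\<beta> = \<alpha>")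
          case True
          then show ?thesis using * chain[of C'] by (auto simp: cuts_\<alpha>)
        next
          case False
          then show ?thesis using * by (simp add: cuts_def)
        qed
        have "osc g (lo j, ?s) + osc g (u, v) + osc g (?t, hi j) < osc g (p j) + \<delta> / 3"
        proof (rule osc_split_less[OF elim(2) p elim(1) j], unfold p_eq)
          show "cuts (lo j, ?s) \<subseteq> cuts (lo j, hi j)" using s by (intro subrelI) blast
          show "cuts (u, v) \<subseteq> cuts (lo j, hi j)" using uv by (intro subrelI) blast
          show "cuts (?t, hi j) \<subseteq> cuts (lo j, hi j)" using t by (intro subrelI)
          show "cuts (lo j, ?s) \<inter> cuts (u, v) = {}" "cuts (lo j, ?s) \<inter> cuts (?t, hi j) = {}"
            "cuts (u, v) \<inter> cuts (?t, hi j) = {}"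
            using s uv by fast+
        qed (use D0[OF j] st u v in auto)
        \<comment> \<open>After cancellation the oscillation of \<open>g\<close> on
          \<open>(u, v)\<close> is below that on \<open>(?s, ?t)\<close> plus \<delta>/3. The latter
          is less than \<delta>/3, from \<open>f\<close>, plus twice \<delta>/6.\<close>
        moreover have "osc g (lo j, hi j) \<le> osc g (lo j, ?s) + \<bar>g ?s - g ?t\<bar> + osc g (?t, hi j)"
          unfolding osc_def fst_conv snd_conv by linarith
        moreover have "\<bar>g ?s - f ?s\<bar> < \<delta> / 6" "\<bar>g ?t - f ?t\<bar> < \<delta> / 6"
          using elim(3) j cd(1,2) by auto
        moreover have "osc g (u, v) = \<bar>g u - g v\<bar>" by (simp add: osc_def)
        ultimately show ?thesis using cd(7) unfolding p_eq by linarith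
      qed
      then show "\<bar>g u - g (u(\<alpha> := b))\<bar> < \<delta>" unfolding v_def .
    qed
  qed
  then show ?thesis using \<open>finite Wt\<close> by blast
qed

section \<open>From finitely many points to uniform convergence\<close>

lemma uniform_convergence:
  assumes f: "f \<in> cont_functions K" and V: "\<forall>\<^sub>F g in F. g \<in> cont_functions K"
    and F: "\<And>x. x \<in> D0 \<Longrightarrow> ((\<lambda>g. g x) \<longlongrightarrow> f x) F"
    and PF: "\<And>n \<eta>. 0 < \<eta> \<Longrightarrow> \<forall>\<^sub>F g in F. P n g < P n f + \<eta>"
    and pf: "principal {f} \<le> F" and "0 < \<epsilon>"
  shows "\<forall>\<^sub>F g in F. sup_norm K (\<lambda>x. f x - g x) \<le> \<epsilon>"
proof -
  \<comment> \<open>Comparing \<open>f x\<close> with \<open>g x\<close> through \<open>h x\<close>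
    costs 2\<eta> for \<open>f\<close>, 2\<eta> for \<open>g\<close>, and \<eta> at
    \<open>h x\<close>.\<close>
  define \<eta> where "\<eta> = \<epsilon> / 5"
  have "0 < \<eta>" using \<open>0 < \<epsilon>\<close> by (simp add: \<eta>_def)
  \<comment> \<open>Thus the estimates for eventually all \<open>g\<close> apply to \<open>f\<close>
    as well.\<close>
  have at_f: "Q f" if "eventually Q F" for Q
    using filter_leD[OF pf that] by (simp add: eventually_principal)
  obtain G where G: "finite G" "G \<subseteq> I" and evG: "\<forall>\<^sub>F g in F. \<forall>u\<in>D0. \<forall>v\<in>D0. (\<forall>\<alpha>\<in>G. u \<alpha> = v \<alpha>) \<longrightarrow> \<bar>g u - g v\<bar> < \<eta>"
    using finite_determining_coordinates[OF f V F PF \<open>0 < \<eta>\<close>] by blast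
  \<comment> \<open>Changing the coordinates in \<open>G\<close> one at a time then costs at most
    \<eta>; the 1 covers an empty \<open>G\<close>.\<close>
  define \<delta> where "\<delta> = \<eta> / (card G + 1)"
  have "0 < \<delta>" using \<open>0 < \<eta>\<close> by (simp add: \<delta>_def)
  have "card G * \<delta> \<le> \<eta>" using \<open>0 < \<eta>\<close> by (simp add: \<delta>_def field_simps)
  have "\<forall>\<alpha>\<in>G. \<exists>W. finite W \<and> (\<forall>\<^sub>F g in F. \<forall>u\<in>D0. \<forall>b\<in>D \<alpha>.
      position \<alpha> W (u \<alpha>) = position \<alpha> W b \<longrightarrow> \<bar>g u - g (u(\<alpha> := b))\<bar> < \<delta>)"
    using G(2) by (intro ballI finite_positions[OF f V F PF \<open>0 < \<delta>\<close>]) auto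
  from bchoice[OF this] obtain W where W: "\<forall>\<alpha>\<in>G. finite (W \<alpha>) \<and> (\<forall>\<^sub>F g in F. \<forall>u\<in>D0. \<forall>b\<in>D \<alpha>.
      position \<alpha> (W \<alpha>) (u \<alpha>) = position \<alpha> (W \<alpha>) b \<longrightarrow> \<bar>g u - g (u(\<alpha> := b))\<bar> < \<delta>)" ..
  \<comment> \<open>One representative per position, so each coordinate in \<open>G\<close> is left
    with finitely many values.\<close>
  define \<rho> where "\<rho> \<alpha> q = (SOME b. b \<in> D \<alpha> \<and> position \<alpha> (W \<alpha>) b = q)" for \<alpha> q
  define rep where "rep \<alpha> a = \<rho> \<alpha> (position \<alpha> (W \<alpha>) a)" for \<alpha> a
  have rep: "rep \<alpha> a \<in> D \<alpha>" "position \<alpha> (W \<alpha>) (rep \<alpha> a) = position \<alpha> (W \<alpha>) a" if "a \<in> D \<alpha>" for \<alpha> a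
    unfolding rep_def \<rho>_def
    using someI[of "\<lambda>b. b \<in> D \<alpha> \<and> position \<alpha> (W \<alpha>) b = position \<alpha> (W \<alpha>) a" a] that by auto
  have fin_rep: "finite (range (rep \<alpha>))" if "\<alpha> \<in> G" for \<alpha>
  proof (rule finite_subset)
    show "range (rep \<alpha>) \<subseteq> \<rho> \<alpha> ` (Pow (W \<alpha>) \<times> Pow (W \<alpha>))"
      by (auto simp: rep_def position_def)
    show "finite (\<rho> \<alpha> ` (Pow (W \<alpha>) \<times> Pow (W \<alpha>)))" using W that by auto
  qed
  \<comment> \<open>\<open>move\<close> passes to representatives on \<open>J\<close> only and
    serves the induction over coordinates. \<open>h\<close> also resets everything outside
    \<open>G\<close> to \<open>e\<close>, so it takes finitely many values on
    \<open>D0\<close>.\<close>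
  define move where "move J x = (\<lambda>\<alpha>. if \<alpha> \<in> J then rep \<alpha> (x \<alpha>) else x \<alpha>)" for J x
  define h where "h x = (\<lambda>\<alpha>. if \<alpha> \<in> G then rep \<alpha> (x \<alpha>) else e \<alpha>)" for x
  have h_D0: "h x \<in> D0" if "x \<in> D0" for x
  proof -
    have "h x \<in> (\<Pi>\<^sub>E \<alpha>\<in>I. D \<alpha>)"
    proof (rule PiE_I)
      show "h x \<alpha> \<in> D \<alpha>" if "\<alpha> \<in> I" for \<alpha>
        using rep(1) D0_coord[OF \<open>x \<in> D0\<close> that] PiE_mem[OF e that] by (simp add: h_def)
      show "h x \<alpha> = undefined" if "\<alpha> \<notin> I" for \<alpha>
        using that G(2) PiE_arb[OF e that] by (auto simp: h_def)
    qed
    moreover have "finite {\<alpha> \<in> I. h x \<alpha> \<noteq> e \<alpha>}"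
      by (rule finite_subset[OF _ G(1)]) (auto simp: h_def)
    ultimately show ?thesis by (simp add: D0_def)
  qed
  have "finite (h ` D0)"
  proof (rule finite_subset)
    show "h ` D0 \<subseteq> (\<lambda>y \<alpha>. if \<alpha> \<in> G then y \<alpha> else e \<alpha>) ` (\<Pi>\<^sub>E \<alpha>\<in>G. range (rep \<alpha>))"
    proof
      fix z assume "z \<in> h ` D0"
      then obtain x where "z = h x" by blast
      then have z: "z = (\<lambda>y \<alpha>. if \<alpha> \<in> G then y \<alpha> else e \<alpha>) (\<lambda>\<alpha>\<in>G. rep \<alpha> (x \<alpha>))"
        by (auto simp: h_def)
      show "z \<in> (\<lambda>y \<alpha>. if \<alpha> \<in> G then y \<alpha> else e \<alpha>) ` (\<Pi>\<^sub>E \<alpha>\<in>G. range (rep \<alpha>))"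
        unfolding z by (rule imageI) auto
    qed
    show "finite ((\<lambda>y \<alpha>. if \<alpha> \<in> G then y \<alpha> else e \<alpha>) ` (\<Pi>\<^sub>E \<alpha>\<in>G. range (rep \<alpha>)))"
      using finite_PiE[OF G(1) fin_rep] by (rule finite_imageI)
  qed
  have ev_h: "\<forall>\<^sub>F g in F. \<forall>x\<in>D0. \<bar>g x - g (h x)\<bar> < 2 * \<eta>"
  proof -
    have "\<forall>\<^sub>F g in F. \<forall>\<alpha>\<in>G. \<forall>u\<in>D0. \<forall>b\<in>D \<alpha>.
      position \<alpha> (W \<alpha>) (u \<alpha>) = position \<alpha> (W \<alpha>) b \<longrightarrow> \<bar>g u - g (u(\<alpha> := b))\<bar> < \<delta>"
      using W by (intro eventually_ball_finite G(1)) auto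
    then show ?thesis
      using evG
    proof eventually_elim
      case (elim g)
      show ?case
      proof
        fix x assume x: "x \<in> D0"
        have "move J x \<in> D0 \<and> \<bar>g x - g (move J x)\<bar> \<le> card J * \<delta>" if "finite J" "J \<subseteq> G" for J
          using that
        proof (induction J rule: finite_induct)
          case empty
          then show ?case using x by (simp add: move_def)
        next
          case (insert \<alpha> J)
          then have IH: "move J x \<in> D0" "\<bar>g x - g (move J x)\<bar> \<le> card J * \<delta>" and "\<alpha> \<in> G" "\<alpha> \<in> I"
            using G(2) by auto
          have eq: "move (insert \<alpha> J) x = (move J x)(\<alpha> := rep \<alpha> (x \<alpha>))"
            by (auto simp: move_def)
          have xa: "x \<alpha> \<in> D \<alpha>" "move J x \<alpha> = x \<alpha>"
            using D0_coord[OF x \<open>\<alpha> \<in> I\<close>] insert.hyps by (auto simp: move_def)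
          have "\<bar>g (move J x) - g (move (insert \<alpha> J) x)\<bar> < \<delta>"
            unfolding eq using elim(1) \<open>\<alpha> \<in> G\<close> IH(1) rep[OF xa(1)] xa(2) by simp
          moreover have "move (insert \<alpha> J) x \<in> D0"
            unfolding eq by (rule D0_update[OF IH(1) \<open>\<alpha> \<in> I\<close> rep(1)[OF xa(1)]])
          ultimately show ?case
            using IH(2) insert.hyps by (simp add: distrib_right)
        qed
        from this[OF G(1) order_refl] have m: "move G x \<in> D0" "\<bar>g x - g (move G x)\<bar> \<le> card G * \<delta>" by auto
        have "\<bar>g (move G x) - g (h x)\<bar> < \<eta>"
          using elim(2) m(1) h_D0[OF x] by (simp add: move_def h_def)
        then show "\<bar>g x - g (h x)\<bar> < 2 * \<eta>"
          using m(2) \<open>card G * \<delta> \<le> \<eta>\<close> by linarith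
      qed
    qed
  qed
  have "\<forall>\<^sub>F g in F. \<forall>z\<in>h ` D0. \<bar>g z - f z\<bar> < \<eta>"
  proof (rule eventually_ball_finite[OF \<open>finite (h ` D0)\<close>], rule ballI)
    fix z assume "z \<in> h ` D0"
    then have "z \<in> D0" using h_D0 by blast
    from tendstoD[OF F[OF this] \<open>0 < \<eta>\<close>] show "\<forall>\<^sub>F g in F. \<bar>g z - f z\<bar> < \<eta>"
      by (simp add: dist_real_def)
  qed
  then show ?thesis
    using ev_h V
  proof eventually_elim
    case (elim g)
    show ?case
    proof (rule sup_norm_le_D0[OF cont_functions_diff[OF f elim(3)]])
      fix x assume x: "x \<in> D0"
      have "\<bar>f x - f (h x)\<bar> < 2 * \<eta>" using at_f[OF ev_h] x by blast
      moreover have "\<bar>g x - g (h x)\<bar> < 2 * \<eta>" "\<bar>g (h x) - f (h x)\<bar> < \<eta>"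
        using elim x by auto
      ultimately show "\<bar>f x - g x\<bar> \<le> \<epsilon>" unfolding \<eta>_def by linarith
    qed (use \<open>0 < \<epsilon>\<close> in simp)
  qed
qed

theorem Kadec_renorming:
  "\<exists>N. norm_on (cont_functions K) N \<and>
       equivalent_norms_on (cont_functions K) N (sup_norm K) \<and>
       Kadec_norm (cont_functions K) (pointwise_topology (cont_functions K) (\<Pi>\<^sub>E \<alpha>\<in>I. D \<alpha>)) N"
proof (rule Kadec_norm_of_seminorms[where P = P and B = "\<lambda>n. 2 * real n + 1"])
  show "\<forall>\<^sub>F g in F. c < P k g"
    if "f \<in> cont_functions K" "\<forall>\<^sub>F g in F. g \<in> cont_functions K"
      "\<forall>x\<in>\<Pi>\<^sub>E \<alpha>\<in>I. D \<alpha>. ((\<lambda>g. g x) \<longlongrightarrow> f x) F" "c < P k f" for f F c k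
    using that D0_subset_PiE by (intro P_lsc) auto
  show "\<forall>\<^sub>F g in F. sup_norm K (\<lambda>x. f x - g x) \<le> \<epsilon>"
    if "f \<in> cont_functions K" "\<forall>\<^sub>F g in F. g \<in> cont_functions K"
      "\<forall>x\<in>\<Pi>\<^sub>E \<alpha>\<in>I. D \<alpha>. ((\<lambda>g. g x) \<longlongrightarrow> f x) F"
      "\<And>k \<eta>. 0 < \<eta> \<Longrightarrow> \<forall>\<^sub>F g in F. P k g < P k f + \<eta>" "principal {f} \<le> F" "0 < \<epsilon>" for f F \<epsilon>
    using that D0_subset_PiE by (intro uniform_convergence) auto
  show "P n f \<le> (2 * n + 1) * sup_norm K f" if "f \<in> cont_functions K" for n f
    by (rule P_le[OF that])
qed (use compact_K PiE_D_subset P_nonneg P_scale P_add sup_norm_le_P1 in auto)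

end

theorem theorem4p9:
  fixes I :: "'i set"
    and L :: "'i \<Rightarrow> 'a set"
    and r :: "'i \<Rightarrow> ('a \<times> 'a) set"
    and D :: "'i \<Rightarrow> 'a set"
  assumes "\<And>\<alpha>. \<alpha> \<in> I \<Longrightarrow> linear_order_on (L \<alpha>) (r \<alpha>)"
    and "\<And>\<alpha>. \<alpha> \<in> I \<Longrightarrow> compact_space (order_top_of (L \<alpha>) (r \<alpha>))"
    and "\<And>\<alpha>. \<alpha> \<in> I \<Longrightarrow> dense_subset_of (order_top_of (L \<alpha>) (r \<alpha>)) (D \<alpha>)"
    and "\<And>\<alpha>. \<alpha> \<in> I \<Longrightarrow> contains_adjacent_pairs (L \<alpha>) (r \<alpha>) (D \<alpha>)"
  defines "K \<equiv> product_topology (\<lambda>\<alpha>. order_top_of (L \<alpha>) (r \<alpha>)) I"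
  shows "\<exists>N. norm_on (cont_functions K) N \<and>
             equivalent_norms_on (cont_functions K) N (sup_norm K) \<and>
             Kadec_norm (cont_functions K)
               (pointwise_topology (cont_functions K) (\<Pi>\<^sub>E \<alpha>\<in>I. D \<alpha>)) N"
proof (cases "(\<Pi>\<^sub>E \<alpha>\<in>I. D \<alpha>) = {}")
  case False
  then obtain e where "e \<in> (\<Pi>\<^sub>E \<alpha>\<in>I. D \<alpha>)" by blast
  with assms(1-4) interpret ordered_product I L r D e by unfold_locales
  show ?thesis unfolding K_def by (rule Kadec_renorming)
next
  \<comment> \<open>Some \<open>D \<alpha>\<close> is empty, hence so is \<open>L \<alpha>\<close>.
    The function space then contains only the zero function, and the supremum norm itself serves for
    every seminorm.\<close>
  case True
  then obtain \<alpha> where \<alpha>: "\<alpha> \<in> I" "D \<alpha> = {}" by (auto simp: PiE_eq_empty_iff)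
  then have "L \<alpha> = {}" using assms(3)[OF \<alpha>(1)] by (simp add: dense_subset_of_def)
  then have K0: "topspace K = {}" using \<alpha>(1) by (auto simp: K_def PiE_eq_empty_iff)
  have sup0: "sup_norm K f = 0" for f by (simp add: sup_norm_def K0)
  have cpt: "compact_space K" using K0 by (simp add: compact_space_def)
  show ?thesis
    by (rule Kadec_norm_of_seminorms[where P = "\<lambda>_. sup_norm K" and B = "\<lambda>_. 1"])
      (use cpt True in \<open>auto simp: sup0\<close>)
qed

end
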